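(* Let $\alpha,\beta>-1$, let $z_0\in(-1,1)$, let $s>0$ be a real number, let $\mu\ge1$ be an integer, let $g\in C^\infty[-1,1]$, and let $f(x)=|x-z_0|^{s}\ln^{\mu}|x-z_0|\,g(x)$. Then the Jacobi coefficients of $f$ satisfy $$|a_n(\alpha,\beta)|=O\big(\ln^{\mu}(n)\,n^{-s-\frac12}\big),\qquad n\to\infty.$$
   Context: For $\alpha,\beta>-1$, $P_n^{(\alpha,\beta)}$ is the Jacobi polynomial of degree $n$ (standard normalization), $\sigma_n^{\alpha,\beta}=\int_{-1}^1(1-x)^\alpha(1+x)^\beta [P_n^{(\alpha,\beta)}(x)]^2\,dx$, and the Jacobi coefficients of $f$ are $$a_n(\alpha,\beta)=\frac{1}{\sigma_n^{\alpha,\beta}}\int_{-1}^{1}(1-x)^{\alpha}(1+x)^{\beta}f(x)P_n^{(\alpha,\beta)}(x)\,dx.$$ The constant in the $O$-term may depend on everything except $n$. *)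

theory Defs
  imports "HOL-Analysis.Analysis" "HOL-Library.Landau_Symbols"
begin

text \<open>
  The Jacobi polynomial of degree \<open>n\<close> in Szego's normalization, i.e. with value
  \<open>n + \<alpha>\<close> choose \<open>n\<close> at \<open>1\<close>. This is the explicit sum
  that results from Rodrigues' formula by the Leibniz rule.
\<close>

definition jacobi_P :: "real \<Rightarrow> real \<Rightarrow> nat \<Rightarrow> real \<Rightarrow> real" where
  "jacobi_P \<alpha> \<beta> n x =
     (\<Sum>k\<le>n. ((real n + \<alpha>) gchoose (n - k)) * ((real n + \<beta>) gchoose k)
              * ((x - 1) / 2) ^ k * ((x + 1) / 2) ^ (n - k))"

lemma jacobi_P_at_1: "jacobi_P \<alpha> \<beta> n 1 = (real n + \<alpha>) gchoose n"
proof -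
  have "jacobi_P \<alpha> \<beta> n 1 = (\<Sum>k\<in>{0::nat}. (real n + \<alpha>) gchoose n)"
    unfolding jacobi_P_def by (rule sum.mono_neutral_cong_right) auto
  then show ?thesis by simp
qed

text \<open>
  At an endpoint with a zero base, \<open>powr\<close> returns \<open>0\<close> also for exponents
  \<open>\<le> 0\<close>; this affects a null set only and hence none of the integrals below.
\<close>

definition jacobi_weight :: "real \<Rightarrow> real \<Rightarrow> real \<Rightarrow> real" where
  "jacobi_weight \<alpha> \<beta> x = (1 - x) powr \<alpha> * (1 + x) powr \<beta>"

definition jacobi_sigma :: "real \<Rightarrow> real \<Rightarrow> nat \<Rightarrow> real" where
  "jacobi_sigma \<alpha> \<beta> n =
     integral {-1..1} (\<lambda>x. jacobi_weight \<alpha> \<beta> x * (jacobi_P \<alpha> \<beta> n x)\<^sup>2)"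

definition jacobi_coeff :: "real \<Rightarrow> real \<Rightarrow> (real \<Rightarrow> real) \<Rightarrow> nat \<Rightarrow> real" where
  "jacobi_coeff \<alpha> \<beta> f n =
     1 / jacobi_sigma \<alpha> \<beta> n *
     integral {-1..1} (\<lambda>x. jacobi_weight \<alpha> \<beta> x * f x * jacobi_P \<alpha> \<beta> n x)"

text \<open>
  Infinitely differentiable on the closed interval, with one-sided derivatives at the
  endpoints; \<open>D k\<close> is the \<open>k\<close>-th derivative of \<open>g\<close>. Values of
  \<open>g\<close> outside the interval are irrelevant.
\<close>

definition smooth_on_Icc :: "real \<Rightarrow> real \<Rightarrow> (real \<Rightarrow> real) \<Rightarrow> bool" where
  "smooth_on_Icc a b g \<longleftrightarrow>
     (\<exists>D :: nat \<Rightarrow> real \<Rightarrow> real.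
        (\<forall>x\<in>{a..b}. D 0 x = g x) \<and>
        (\<forall>k. \<forall>x\<in>{a..b}. (D k has_real_derivative D (Suc k) x) (at x within {a..b})))"

end

theory Submission
  imports Defs
begin

text \<open>
  By Rodrigues' formula the weighted polynomial \<open>w\<^bsub>\<alpha>,\<beta>\<^esub> P\<^sub>n\<close> is,
  up to a factor \<open>O(n powr (- K))\<close>, the \<open>K\<close>-th derivative of
  \<open>q = w\<^bsub>\<alpha>+K,\<beta>+K\<^esub> P\<^bsub>n-K\<^esub>\<close>, which vanishes at \<open>\<plusminus>1\<close>.
  On \<open>\<bar>x - z\<^sub>0\<bar> \<ge> 1 / n\<close> one integrates by parts \<open>K > s + 1\<close> times; the boundary terms at
  \<open>z\<^sub>0 \<plusminus> 1 / n\<close>, the remaining integral and the trivial estimate on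
  \<open>\<bar>x - z\<^sub>0\<bar> \<le> 1 / n\<close> all have size
  \<open>ln n ^ \<mu> * n powr (- s - 1)\<close> times a bound for \<open>q\<close> near \<open>z\<^sub>0\<close>.
  That bound is a multiple of \<open>sqrt \<sigma>\<^sub>n\<close>: the Sonine-type energy
  \<open>E = P\<^sub>n\<^sup>2 + \<kappa> (1 - x\<^sup>2) (P\<^bsub>n-1\<^esub>\<^bsup>(\<alpha>+1,\<beta>+1)\<^esup>)\<^sup>2\<close>
  satisfies \<open>\<bar>E'\<bar> \<le> M E\<close> on compact subintervals with \<open>M\<close> independent of \<open>n\<close>, and
  its weighted integral is exactly \<open>2 \<sigma>\<^sub>n\<close>. Dividing by \<open>\<sigma>\<^sub>n\<close> leaves
  \<open>1 / sqrt \<sigma>\<^sub>n\<close>, and \<open>n \<sigma>\<^sub>n\<close> has a positive limit.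
\<close>

section \<open>Differentiation formulas for Jacobi polynomials\<close>

lemma gbinomial_Suc_absorb:
  fixes a :: real
  shows "(real k + 1) * (a gchoose Suc k) = (a - real k) * (a gchoose k)"
  using gbinomial_absorption[of k a] gbinomial_absorb_comp[of a k] by (simp add: algebra_simps)

text \<open>The explicit sum is differentiated term by term. Raising both parameters while lowering
  the degree keeps the upper arguments \<open>a\<close> and \<open>b\<close> of the binomials, so
  absorption turns the two sums into multiples of the same terms; their factors \<open>b - k\<close>
  and \<open>a - (n - k)\<close> add up to \<open>a + b - n\<close>, which is free of
  \<open>k\<close>.\<close>

lemma has_real_derivative_jacobi_P:
  "(jacobi_P \<alpha> \<beta> (Suc n) has_real_derivative
     (real n + \<alpha> + \<beta> + 2) / 2 * jacobi_P (\<alpha> + 1) (\<beta> + 1) n x) (at x)"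
proof -
  define a b where "a = real n + \<alpha> + 1" and "b = real n + \<beta> + 1"
  define X Y where "X = (x - 1) / 2" and "Y = (x + 1) / 2"
  define c where "c k = (a gchoose (Suc n - k)) * (b gchoose k)" for k
  define d where "d k = (a gchoose (n - k)) * (b gchoose k)" for k
  have "(jacobi_P \<alpha> \<beta> (Suc n) has_real_derivative
     (\<Sum>k\<le>Suc n. c k * (real k * X ^ (k - 1) / 2 * Y ^ (Suc n - k)
       + X ^ k * (real (Suc n - k) * Y ^ (Suc n - k - 1) / 2)))) (at x)"
    unfolding jacobi_P_def X_def Y_def c_def a_def b_def
    by (rule derivative_eq_intros refl | simp add: algebra_simps)+
  also have "(\<Sum>k\<le>Suc n. c k * (real k * X ^ (k - 1) / 2 * Y ^ (Suc n - k)
       + X ^ k * (real (Suc n - k) * Y ^ (Suc n - k - 1) / 2)))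
     = (\<Sum>k\<le>Suc n. c k * real k * X ^ (k - 1) * Y ^ (Suc n - k)) / 2
       + (\<Sum>k\<le>Suc n. c k * real (Suc n - k) * X ^ k * Y ^ (Suc n - k - 1)) / 2"
    unfolding sum_divide_distrib sum.distrib[symmetric]
    by (rule sum.cong) (auto simp: algebra_simps)
  also have "(\<Sum>k\<le>Suc n. c k * real k * X ^ (k - 1) * Y ^ (Suc n - k))
     = (\<Sum>k\<le>n. (b - real k) * d k * X ^ k * Y ^ (n - k))"
    unfolding sum.atMost_Suc_shift
  proof (simp, intro sum.cong refl, goal_cases)
    case (1 k)
    have "c (Suc k) * (1 + real k) = (b - real k) * d k"
      using arg_cong[OF gbinomial_Suc_absorb[of k b], of "\<lambda>t. t * (a gchoose (n - k))"]
      by (simp add: c_def d_def algebra_simps)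
    then show ?case by (simp only: )
  qed
  also have "(\<Sum>k\<le>Suc n. c k * real (Suc n - k) * X ^ k * Y ^ (Suc n - k - 1))
     = (\<Sum>k\<le>n. (a - real (n - k)) * d k * X ^ k * Y ^ (n - k))"
    unfolding sum.atMost_Suc
  proof (simp, intro sum.cong refl, goal_cases)
    case (1 k)
    then have "Suc n - k = Suc (n - k)" by auto
    then have "c k * (1 + real n - real k) = (a - (real n - real k)) * d k"
      using arg_cong[OF gbinomial_Suc_absorb[of "n - k" a], of "\<lambda>t. t * (b gchoose k)"] 1
      by (simp add: c_def d_def algebra_simps of_nat_diff)
    then show ?case by (simp only: )
  qed
  also have "(\<Sum>k\<le>n. (b - real k) * d k * X ^ k * Y ^ (n - k)) / 2
      + (\<Sum>k\<le>n. (a - real (n - k)) * d k * X ^ k * Y ^ (n - k)) / 2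
    = (\<Sum>k\<le>n. (a + b - real n) / 2 * (d k * X ^ k * Y ^ (n - k)))"
    unfolding sum_divide_distrib sum.distrib[symmetric]
    by (rule sum.cong) (auto simp: algebra_simps of_nat_diff diff_divide_distrib add_divide_distrib)
  also have "\<dots> = (real n + \<alpha> + \<beta> + 2) / 2 * jacobi_P (\<alpha> + 1) (\<beta> + 1) n x"
    unfolding sum_distrib_left[symmetric]
    by (simp add: jacobi_P_def d_def a_def b_def X_def Y_def algebra_simps)
  finally show ?thesis .
qed

lemma continuous_on_jacobi_P [continuous_intros]:
  "continuous_on S h \<Longrightarrow> continuous_on S (\<lambda>x. jacobi_P \<alpha> \<beta> n (h x))"
  unfolding jacobi_P_def by (intro continuous_intros) auto

lemma has_real_derivative_jacobi_weight:
  assumes "-1 < x" "x < 1"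
  shows "(jacobi_weight (\<alpha> + 1) (\<beta> + 1) has_real_derivative
           jacobi_weight \<alpha> \<beta> x * ((\<beta> + 1) * (1 - x) - (\<alpha> + 1) * (1 + x))) (at x)"
proof -
  have "((\<lambda>x. (1 - x) powr (\<alpha> + 1)) has_real_derivative (\<alpha> + 1) * (1 - x) powr \<alpha> * (- 1)) (at x)"
    using assms by (intro DERIV_fun_powr[THEN DERIV_cong]) (auto intro!: derivative_eq_intros)
  moreover have "((\<lambda>x. (1 + x) powr (\<beta> + 1)) has_real_derivative (\<beta> + 1) * (1 + x) powr \<beta> * 1) (at x)"
    using assms by (intro DERIV_fun_powr[THEN DERIV_cong]) (auto intro!: derivative_eq_intros)
  ultimately have "((\<lambda>x. (1 - x) powr (\<alpha> + 1) * (1 + x) powr (\<beta> + 1)) has_real_derivative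
      (\<alpha> + 1) * (1 - x) powr \<alpha> * (- 1) * (1 + x) powr (\<beta> + 1)
      + (\<beta> + 1) * (1 + x) powr \<beta> * 1 * (1 - x) powr (\<alpha> + 1)) (at x)"
    by (rule DERIV_mult)
  then show ?thesis
    unfolding jacobi_weight_def
    by (rule DERIV_cong) (use assms in \<open>simp add: powr_add algebra_simps\<close>)
qed

lemma jacobi_weight_Suc:
  assumes "-1 \<le> x" "x \<le> 1"
  shows "jacobi_weight (\<alpha> + 1) (\<beta> + 1) x = (1 - x\<^sup>2) * jacobi_weight \<alpha> \<beta> x"
  using assms by (auto simp: jacobi_weight_def powr_add algebra_simps power2_eq_square)

text \<open>The left side is the derivative of the weighted polynomial with the weight divided out.
  In \<open>X\<close> and \<open>Y\<close> its coefficients are \<open>- 4 * X * Y\<close> and a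
  linear form, so all terms are homogeneous of degree \<open>n + 1\<close>; absorption leaves the
  terms with \<open>c k\<close> with multiplicities \<open>n + 1 - k\<close> and \<open>k\<close>,
  whose sum is constant.\<close>

lemma jacobi_P_raise:
  "(1 - x\<^sup>2) * P' + ((\<beta> + 1) * (1 - x) - (\<alpha> + 1) * (1 + x)) * jacobi_P (\<alpha> + 1) (\<beta> + 1) n x
     = - 2 * (real n + 1) * jacobi_P \<alpha> \<beta> (Suc n) x"
  if "(jacobi_P (\<alpha> + 1) (\<beta> + 1) n has_real_derivative P') (at x)"
proof -
  define a b where "a = real n + \<alpha> + 1" and "b = real n + \<beta> + 1"
  define X Y where "X = (x - 1) / 2" and "Y = (x + 1) / 2"
  define c where "c k = (a gchoose (Suc n - k)) * (b gchoose k)" for k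
  define d where "d k = (a gchoose (n - k)) * (b gchoose k)" for k
  have "(jacobi_P (\<alpha> + 1) (\<beta> + 1) n has_real_derivative
     (\<Sum>k\<le>n. d k * (real k * X ^ (k - 1) / 2 * Y ^ (n - k)
       + X ^ k * (real (n - k) * Y ^ (n - k - 1) / 2)))) (at x)"
    unfolding jacobi_P_def X_def Y_def d_def a_def b_def
    by (rule derivative_eq_intros refl | simp add: algebra_simps)+
  with that have P': "P' = (\<Sum>k\<le>n. d k * (real k * X ^ (k - 1) / 2 * Y ^ (n - k)
       + X ^ k * (real (n - k) * Y ^ (n - k - 1) / 2)))"
    by (rule DERIV_unique)
  have P: "jacobi_P (\<alpha> + 1) (\<beta> + 1) n x = (\<Sum>k\<le>n. d k * (X ^ k * Y ^ (n - k)))"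
    by (simp add: jacobi_P_def d_def a_def b_def X_def Y_def algebra_simps)
  have "(1 - x\<^sup>2) * P' + ((\<beta> + 1) * (1 - x) - (\<alpha> + 1) * (1 + x)) * jacobi_P (\<alpha> + 1) (\<beta> + 1) n x
     = - 4 * X * Y * P' - 2 * ((\<beta> + 1) * X + (\<alpha> + 1) * Y) * jacobi_P (\<alpha> + 1) (\<beta> + 1) n x"
    by (simp add: X_def Y_def power2_eq_square field_simps)
  also have "\<dots> = -2 * (\<Sum>k\<le>n. d k * (real k + \<alpha> + 1) * (X ^ k * Y ^ (Suc n - k))
                      + d k * (real (n - k) + \<beta> + 1) * (X ^ Suc k * Y ^ (n - k)))"
    unfolding P' P sum_distrib_left sum_subtractf[symmetric]
  proof (intro sum.cong refl, goal_cases)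
    case (1 k)
    then have "Suc n - k = Suc (n - k)" by auto
    then show ?case
      by (cases k; cases "n - k") (simp_all add: field_simps)
  qed
  also have "\<dots> = -2 * ((\<Sum>k\<le>n. (real n + 1 - real k) * c k * (X ^ k * Y ^ (Suc n - k)))
                      + (\<Sum>k\<le>n. (real k + 1) * c (Suc k) * (X ^ Suc k * Y ^ (n - k))))"
    unfolding sum.distrib
  proof (intro arg_cong2[where f="\<lambda>u v. - 2 * (u + v)"] sum.cong refl, goal_cases)
    case (1 k)
    then have "Suc n - k = Suc (n - k)" by auto
    then have "d k * (real k + \<alpha> + 1) = (real n + 1 - real k) * c k"
      using arg_cong[OF gbinomial_Suc_absorb[of "n - k" a], of "\<lambda>t. t * (b gchoose k)"] 1
      by (simp add: c_def d_def a_def algebra_simps of_nat_diff)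
    then show ?case by (simp only: )
  next
    case (2 k)
    have "d k * (real (n - k) + \<beta> + 1) = (real k + 1) * c (Suc k)"
      using arg_cong[OF gbinomial_Suc_absorb[of k b], of "\<lambda>t. t * (a gchoose (n - k))"] 2
      by (simp add: c_def d_def b_def algebra_simps of_nat_diff)
    then show ?case by (simp only: )
  qed
  \<comment> \<open>Both sums are brought to the range \<open>k \<le> Suc n\<close>: here the new
    summand has the factor \<open>n + 1 - (n + 1) = 0\<close>, and in the shifted sum below the
    summand \<open>k = 0\<close> has the factor \<open>0\<close>.\<close>
  also have "(\<Sum>k\<le>n. (real n + 1 - real k) * c k * (X ^ k * Y ^ (Suc n - k)))
    = (\<Sum>k\<le>Suc n. (real n + 1 - real k) * c k * (X ^ k * Y ^ (Suc n - k)))"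
    by simp
  also have "(\<Sum>k\<le>n. (real k + 1) * c (Suc k) * (X ^ Suc k * Y ^ (n - k)))
    = (\<Sum>k\<le>Suc n. real k * c k * (X ^ k * Y ^ (Suc n - k)))"
    unfolding sum.atMost_Suc_shift by (simp add: algebra_simps)
  also have "(\<Sum>k\<le>Suc n. (real n + 1 - real k) * c k * (X ^ k * Y ^ (Suc n - k)))
      + (\<Sum>k\<le>Suc n. real k * c k * (X ^ k * Y ^ (Suc n - k)))
    = (\<Sum>k\<le>Suc n. (real n + 1) * (c k * X ^ k * Y ^ (Suc n - k)))"
    unfolding sum.distrib[symmetric] by (rule sum.cong) (auto simp: algebra_simps)
  also have "\<dots> = (real n + 1) * jacobi_P \<alpha> \<beta> (Suc n) x"
    unfolding sum_distrib_left[symmetric]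
    by (simp add: jacobi_P_def c_def a_def b_def X_def Y_def algebra_simps)
  finally show ?thesis by (simp add: algebra_simps)
qed

lemma jacobi_P_differentiable: "\<exists>D. (jacobi_P \<alpha> \<beta> n has_real_derivative D) (at x)"
proof (cases n)
  case 0
  then have "jacobi_P \<alpha> \<beta> n = (\<lambda>_. 1)" by (simp add: jacobi_P_def fun_eq_iff)
  then show ?thesis by (auto intro: DERIV_const)
next
  case (Suc m)
  then show ?thesis using has_real_derivative_jacobi_P by blast
qed

text \<open>One rung of Rodrigues' formula: \<open>jacobi_weight_Suc\<close> pulls out the lower
  weight and \<open>jacobi_P_raise\<close> evaluates what remains.\<close>

lemma has_real_derivative_jacobi_weight_P:
  assumes "-1 < x" "x < 1"
  shows "((\<lambda>x. jacobi_weight (\<alpha> + 1) (\<beta> + 1) x * jacobi_P (\<alpha> + 1) (\<beta> + 1) n x)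
            has_real_derivative
          - 2 * (real n + 1) * (jacobi_weight \<alpha> \<beta> x * jacobi_P \<alpha> \<beta> (Suc n) x)) (at x)"
proof -
  obtain P' where P': "(jacobi_P (\<alpha> + 1) (\<beta> + 1) n has_real_derivative P') (at x)"
    using jacobi_P_differentiable by blast
  show ?thesis
  proof (rule DERIV_cong)
    show "((\<lambda>x. jacobi_weight (\<alpha> + 1) (\<beta> + 1) x * jacobi_P (\<alpha> + 1) (\<beta> + 1) n x)
      has_real_derivative
        jacobi_weight \<alpha> \<beta> x * ((\<beta> + 1) * (1 - x) - (\<alpha> + 1) * (1 + x)) * jacobi_P (\<alpha> + 1) (\<beta> + 1) n x
        + P' * jacobi_weight (\<alpha> + 1) (\<beta> + 1) x) (at x)"
      by (rule DERIV_mult[OF has_real_derivative_jacobi_weight[OF assms] P'])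
    have "jacobi_weight \<alpha> \<beta> x * ((\<beta> + 1) * (1 - x) - (\<alpha> + 1) * (1 + x)) * jacobi_P (\<alpha> + 1) (\<beta> + 1) n x
        + P' * jacobi_weight (\<alpha> + 1) (\<beta> + 1) x
      = jacobi_weight \<alpha> \<beta> x * ((1 - x\<^sup>2) * P'
          + ((\<beta> + 1) * (1 - x) - (\<alpha> + 1) * (1 + x)) * jacobi_P (\<alpha> + 1) (\<beta> + 1) n x)"
      using assms by (subst jacobi_weight_Suc) (auto simp: algebra_simps)
    then show "jacobi_weight \<alpha> \<beta> x * ((\<beta> + 1) * (1 - x) - (\<alpha> + 1) * (1 + x)) * jacobi_P (\<alpha> + 1) (\<beta> + 1) n x
        + P' * jacobi_weight (\<alpha> + 1) (\<beta> + 1) x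
      = - 2 * (real n + 1) * (jacobi_weight \<alpha> \<beta> x * jacobi_P \<alpha> \<beta> (Suc n) x)"
      unfolding jacobi_P_raise[OF P'] by simp
  qed
qed

section \<open>The norms of the Jacobi polynomials\<close>

lemma jacobi_weight_nonneg [simp]: "0 \<le> jacobi_weight \<alpha> \<beta> x"
  by (simp add: jacobi_weight_def)

lemma continuous_on_jacobi_weight:
  assumes "\<alpha> > 0" "\<beta> > 0"
  shows "continuous_on {-1..1} (jacobi_weight \<alpha> \<beta>)"
  unfolding jacobi_weight_def using assms
  by (intro continuous_on_mult continuous_on_powr' continuous_intros) auto

text \<open>The substitution \<open>t = (1 + x) / 2\<close> reduces this to Euler's Beta integral.
  It also yields integrability for exponents in \<open>(-1, 0)\<close>, where the weight is
  unbounded.\<close>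

lemma has_integral_jacobi_weight:
  assumes "\<alpha> > -1" "\<beta> > -1"
  shows "(jacobi_weight \<alpha> \<beta> has_integral
           2 powr (\<alpha> + \<beta> + 1) * Beta (\<alpha> + 1) (\<beta> + 1)) {-1..1}"
proof -
  have "((\<lambda>t. t powr (\<beta> + 1 - 1) * (1 - t) powr (\<alpha> + 1 - 1)) has_integral
          Beta (\<beta> + 1) (\<alpha> + 1)) {0..1}"
    using assms by (intro has_integral_Beta_real) auto
  then have "((\<lambda>t. t powr \<beta> * (1 - t) powr \<alpha>) has_integral Beta (\<alpha> + 1) (\<beta> + 1)) (cbox 0 1)"
    by (simp add: Beta_commute)
  from has_integral_affinity[OF this, of "1 / 2" "1 / 2"]
  have "((\<lambda>x. (x / 2 + 1 / 2) powr \<beta> * (1 - (x / 2 + 1 / 2)) powr \<alpha>) has_integral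
          2 * Beta (\<alpha> + 1) (\<beta> + 1)) ((\<lambda>x. 2 * x - 1) ` {0..1})"
    by (simp add: algebra_simps)
  also have "((\<lambda>x::real. 2 * x - 1) ` {0..1}) = {-1..1}"
  proof -
    have "x \<in> (\<lambda>x::real. 2 * x - 1) ` {0..1}" if "x \<in> {-1..1}" for x
      using that by (intro image_eqI[of _ _ "(x + 1) / 2"]) (auto simp: field_simps)
    then show ?thesis by auto
  qed
  finally have "((\<lambda>x. 2 powr (\<alpha> + \<beta>) * ((x / 2 + 1 / 2) powr \<beta> * (1 - (x / 2 + 1 / 2)) powr \<alpha>))
      has_integral 2 powr (\<alpha> + \<beta>) * (2 * Beta (\<alpha> + 1) (\<beta> + 1))) {-1..1}"
    by (rule has_integral_mult_right)
  moreover have "2 powr (\<alpha> + \<beta>) * (2 * Beta (\<alpha> + 1) (\<beta> + 1))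
      = 2 powr (\<alpha> + \<beta> + 1) * Beta (\<alpha> + 1) (\<beta> + 1)"
    by (simp add: powr_add)
  moreover have "2 powr (\<alpha> + \<beta>) * ((x / 2 + 1 / 2) powr \<beta> * (1 - (x / 2 + 1 / 2)) powr \<alpha>)
      = jacobi_weight \<alpha> \<beta> x" if "x \<in> {-1..1}" for x
  proof -
    have "(x / 2 + 1 / 2) powr \<beta> = (1 + x) powr \<beta> / 2 powr \<beta>"
      using that by (subst powr_divide[symmetric]) (auto simp: field_simps)
    moreover have "(1 - (x / 2 + 1 / 2)) powr \<alpha> = (1 - x) powr \<alpha> / 2 powr \<alpha>"
      using that by (subst powr_divide[symmetric]) (auto simp: field_simps)
    ultimately show ?thesis by (simp add: jacobi_weight_def powr_add)
  qed
  ultimately show ?thesis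
    by (metis (no_types, lifting) has_integral_cong)
qed

lemma integrable_jacobi_weight_mult:
  fixes h :: "real \<Rightarrow> real"
  assumes "\<alpha> > -1" "\<beta> > -1" "continuous_on {-1..1} h"
  shows "(\<lambda>x. jacobi_weight \<alpha> \<beta> x * h x) integrable_on {-1..1}"
proof -
  have "jacobi_weight \<alpha> \<beta> absolutely_integrable_on {-1..1}"
    using has_integral_jacobi_weight[OF assms(1,2)]
    by (intro nonnegative_absolutely_integrable_1) (auto simp: has_integral_iff)
  moreover have "h \<in> borel_measurable (lebesgue_on {-1..1})"
    using assms(3) by (rule continuous_imp_measurable_on_sets_lebesgue) auto
  moreover have "bounded (h ` {-1..1})"
    using assms(3) by (intro compact_imp_bounded compact_continuous_image) auto
  ultimately have "(\<lambda>x. h x * jacobi_weight \<alpha> \<beta> x) absolutely_integrable_on {-1..1}"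
    by (intro absolutely_integrable_bounded_measurable_product_real) auto
  then show ?thesis
    by (simp add: mult.commute absolutely_integrable_on_def)
qed

lemma has_integral_jacobi_sigma:
  assumes "\<alpha> > -1" "\<beta> > -1"
  shows "((\<lambda>x. jacobi_weight \<alpha> \<beta> x * (jacobi_P \<alpha> \<beta> n x)\<^sup>2) has_integral jacobi_sigma \<alpha> \<beta> n) {-1..1}"
  unfolding jacobi_sigma_def
  by (intro integrable_integral integrable_jacobi_weight_mult assms continuous_intros)

text \<open>The product of \<open>q\<close> and the polynomial of degree \<open>Suc n\<close>
  vanishes at both endpoints, because the weight in \<open>q\<close> has positive exponents. Its
  derivative therefore integrates to \<open>0\<close>, and by the two differentiation formulas that
  derivative is a combination of the two squared integrands.\<close>

lemma jacobi_sigma_Suc: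
  assumes "\<alpha> > -1" "\<beta> > -1"
  shows "jacobi_sigma \<alpha> \<beta> (Suc n)
           = (real n + \<alpha> + \<beta> + 2) / (4 * (real n + 1)) * jacobi_sigma (\<alpha> + 1) (\<beta> + 1) n"
proof -
  define q where "q x = jacobi_weight (\<alpha> + 1) (\<beta> + 1) x * jacobi_P (\<alpha> + 1) (\<beta> + 1) n x" for x
  define A where "A x = jacobi_weight \<alpha> \<beta> x * (jacobi_P \<alpha> \<beta> (Suc n) x)\<^sup>2" for x
  define B where "B x = jacobi_weight (\<alpha> + 1) (\<beta> + 1) x * (jacobi_P (\<alpha> + 1) (\<beta> + 1) n x)\<^sup>2" for x
  have "((\<lambda>x. - 2 * (real n + 1) * A x + (real n + \<alpha> + \<beta> + 2) / 2 * B x) has_integral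
          q 1 * jacobi_P \<alpha> \<beta> (Suc n) 1 - q (-1) * jacobi_P \<alpha> \<beta> (Suc n) (-1)) {-1..1}"
  proof (rule fundamental_theorem_of_calculus_interior)
    show "continuous_on {-1..1} (\<lambda>x. q x * jacobi_P \<alpha> \<beta> (Suc n) x)"
      unfolding q_def using assms by (intro continuous_intros continuous_on_jacobi_weight) auto
    fix x :: real assume "x \<in> {-1<..<1}"
    then have "(q has_real_derivative
        - 2 * (real n + 1) * (jacobi_weight \<alpha> \<beta> x * jacobi_P \<alpha> \<beta> (Suc n) x)) (at x)"
      unfolding q_def by (intro has_real_derivative_jacobi_weight_P) auto
    from DERIV_mult[OF this has_real_derivative_jacobi_P]
    show "((\<lambda>x. q x * jacobi_P \<alpha> \<beta> (Suc n) x) has_vector_derivative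
             - 2 * (real n + 1) * A x + (real n + \<alpha> + \<beta> + 2) / 2 * B x) (at x)"
      unfolding has_real_derivative_iff_has_vector_derivative[symmetric]
      by (rule DERIV_cong) (simp add: A_def B_def q_def power2_eq_square algebra_simps)
  qed simp
  then have "((\<lambda>x. - 2 * (real n + 1) * A x + (real n + \<alpha> + \<beta> + 2) / 2 * B x) has_integral 0) {-1..1}"
    by (simp add: q_def jacobi_weight_def)
  moreover have "((\<lambda>x. - 2 * (real n + 1) * A x + (real n + \<alpha> + \<beta> + 2) / 2 * B x) has_integral
      - 2 * (real n + 1) * jacobi_sigma \<alpha> \<beta> (Suc n)
      + (real n + \<alpha> + \<beta> + 2) / 2 * jacobi_sigma (\<alpha> + 1) (\<beta> + 1) n) {-1..1}"
    unfolding A_def B_def using assms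
    by (intro has_integral_add has_integral_mult_right has_integral_jacobi_sigma) auto
  ultimately have "- 2 * (real n + 1) * jacobi_sigma \<alpha> \<beta> (Suc n)
      + (real n + \<alpha> + \<beta> + 2) / 2 * jacobi_sigma (\<alpha> + 1) (\<beta> + 1) n = 0"
    by (rule has_integral_unique[symmetric])
  then show ?thesis by (simp add: field_simps)
qed

text \<open>The recursion is iterated down to degree \<open>0\<close>, where the norm is the
  integral of the weight. Each step raises both parameters, so they are generalized in the
  induction; the quantity \<open>n + \<alpha> + \<beta>\<close> grows by one per step, and the
  factors collect into the Pochhammer symbol.\<close>

lemma jacobi_sigma_eq_Beta:
  assumes "\<alpha> > -1" "\<beta> > -1"
  shows "jacobi_sigma \<alpha> \<beta> n = pochhammer (real n + \<alpha> + \<beta> + 1) n / (4 ^ n * fact n) *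
           (2 powr (2 * real n + \<alpha> + \<beta> + 1) * Beta (real n + \<alpha> + 1) (real n + \<beta> + 1))"
  using assms
proof (induction n arbitrary: \<alpha> \<beta>)
  case 0
  then show ?case
    using has_integral_jacobi_weight[of \<alpha> \<beta>]
    by (simp add: jacobi_sigma_def jacobi_P_def integral_unique)
next
  case (Suc n)
  have "jacobi_sigma (\<alpha> + 1) (\<beta> + 1) n
      = pochhammer (real n + (\<alpha> + 1) + (\<beta> + 1) + 1) n / (4 ^ n * fact n) *
          (2 powr (2 * real n + (\<alpha> + 1) + (\<beta> + 1) + 1)
             * Beta (real n + (\<alpha> + 1) + 1) (real n + (\<beta> + 1) + 1))"
    using Suc.prems by (intro Suc.IH) auto
  then show ?case
    using Suc.prems by (simp add: jacobi_sigma_Suc pochhammer_rec add_ac mult_ac)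
qed

section \<open>Gamma form, asymptotics and parameter shifts of the norms\<close>

lemma jacobi_sigma_nonneg: "0 \<le> jacobi_sigma \<alpha> \<beta> n"
  unfolding jacobi_sigma_def
  by (cases "(\<lambda>x. jacobi_weight \<alpha> \<beta> x * (jacobi_P \<alpha> \<beta> n x)\<^sup>2) integrable_on {-1..1}")
     (auto intro: integral_nonneg simp: not_integrable_integral)

text \<open>The classical closed form of the norm. It is stated for positive degree because in
  degree \<open>0\<close> the classical denominator \<open>Gamma (\<alpha> + \<beta> + 1)\<close>
  can sit at a pole.\<close>

lemma jacobi_sigma_Suc_Gamma:
  assumes "\<alpha> > -1" "\<beta> > -1"
  shows "jacobi_sigma \<alpha> \<beta> (Suc n) =
    2 powr (\<alpha> + \<beta> + 1) * (real n + \<alpha> + \<beta> + 2) / (2 * real n + \<alpha> + \<beta> + 3)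
    * (Gamma (real n + \<alpha> + 2) * Gamma (real n + \<beta> + 2) / (fact (Suc n) * Gamma (real n + \<alpha> + \<beta> + 3)))"
proof -
  define c where "c = \<alpha> + \<beta> + 2"
  define N where "N = Suc n"
  have c: "c > 0" using assms by (simp add: c_def)
  have "real N + c \<notin> \<int>\<^sub>\<le>\<^sub>0"
    using c nonpos_Ints_nonpos[of "real N + c"] by fastforce
  moreover have G: "Gamma (real N + c) > 0" "Gamma (2 * real N + c) > 0"
    using c by (auto intro!: Gamma_real_pos)
  ultimately have "pochhammer (real N + c) N * Gamma (real N + c) = Gamma (2 * real N + c)"
    by (subst pochhammer_Gamma) (auto simp: add_ac)
  \<comment> \<open>Both sides are \<open>pochhammer (N + c - 1) (Suc N)\<close>, with the first or
    the last factor split off.\<close>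
  moreover have "(real N + c - 1) * pochhammer (real N + c) N
      = pochhammer (real N + c - 1) N * (2 * real N + c - 1)"
    using pochhammer_rec[of "real N + c - 1" N] pochhammer_rec'[of "real N + c - 1" N]
    by (simp add: algebra_simps)
  ultimately have "(real N + c - 1) * Gamma (2 * real N + c)
      = pochhammer (real N + c - 1) N * (2 * real N + c - 1) * Gamma (real N + c)"
    by (metis mult.assoc)
  moreover have "2 * real N + c - 1 > 0" using c by (simp add: N_def)
  ultimately have key: "pochhammer (real N + c - 1) N / Gamma (2 * real N + c)
      = (real N + c - 1) / ((2 * real N + c - 1) * Gamma (real N + c))"
    using G by (subst frac_eq_eq) (simp_all only: less_imp_neq[symmetric] mult_eq_0_iff, simp_all add: mult_ac)
  have p: "(2::real) powr (2 * real N + \<alpha> + \<beta> + 1) = 4 ^ N * 2 powr (\<alpha> + \<beta> + 1)"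
  proof -
    have "(2::real) powr (2 * real N) = 4 ^ N"
      using powr_powr[of 2 2 "real N"] by (simp add: powr_realpow)
    then show ?thesis by (simp add: powr_add add.assoc)
  qed
  have "jacobi_sigma \<alpha> \<beta> N = 2 powr (\<alpha> + \<beta> + 1) / fact N
      * (Gamma (real N + \<alpha> + 1) * Gamma (real N + \<beta> + 1))
      * (pochhammer (real N + c - 1) N / Gamma (2 * real N + c))"
    unfolding jacobi_sigma_eq_Beta[OF assms] p Beta_def
    by (simp add: c_def algebra_simps)
  then show ?thesis
    unfolding key by (simp add: N_def c_def add_ac mult_ac)
qed

text \<open>Each Gamma value is rewritten through \<open>Gamma_series\<close>, which converges to
  Gamma. The powers of \<open>n\<close> so exposed cancel because \<open>a + b = c\<close>, the
  factorials leave \<open>1 / (n + 1)\<close>, and the remaining rational factor tends to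
  \<open>1 / 2\<close>.\<close>

lemma tendsto_jacobi_sigma:
  assumes "\<alpha> > -1" "\<beta> > -1"
  shows "(\<lambda>n. real n * jacobi_sigma \<alpha> \<beta> n) \<longlonglongrightarrow> 2 powr (\<alpha> + \<beta>)"
proof -
  define a b c where "a = \<alpha> + 1" and "b = \<beta> + 1" and "c = \<alpha> + \<beta> + 2"
  have pos: "a > 0" "b > 0" "c > 0" using assms by (auto simp: a_def b_def c_def)
  \<comment> \<open>The definition of \<open>Gamma_series\<close> solved for the shifted Gamma
    value, which makes its growth \<open>fact n * n powr z\<close> explicit.\<close>
  have Gamma_shift: "Gamma (real (Suc n) + z) = Gamma z * fact n * exp (z * ln (real n)) / Gamma_series z n"
    if "z > 0" for z :: real and n
  proof -
    have "z \<notin> \<int>\<^sub>\<le>\<^sub>0" using that nonpos_Ints_nonpos[of z] by fastforce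
    then have "pochhammer z (Suc n) = Gamma (z + of_nat (Suc n)) / Gamma z"
      by (rule pochhammer_Gamma)
    moreover have "Gamma z > 0" "pochhammer z (Suc n) > 0"
      using that by (auto intro: Gamma_real_pos pochhammer_pos)
    ultimately show ?thesis by (simp add: Gamma_series_def field_simps)
  qed
  have frac: "(\<lambda>n. (real n + c) / (2 * real n + c + 1)) \<longlonglongrightarrow> 1 / 2"
  proof -
    have "((\<lambda>n. (1 + c / real n) / (2 + (c + 1) / real n)) \<longlongrightarrow> (1 + 0) / (2 + 0)) sequentially"
      by (intro tendsto_intros lim_const_over_n) auto
    moreover have "\<forall>\<^sub>F n in sequentially. (1 + c / real n) / (2 + (c + 1) / real n)
        = (real n + c) / (2 * real n + c + 1)"
      using eventually_gt_at_top[of 0]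
    proof eventually_elim
      case (elim n)
      have "(real n + c) / (2 * real n + c + 1) = ((real n + c) / real n) / ((2 * real n + c + 1) / real n)"
        using elim by simp
      also have "(real n + c) / real n = 1 + c / real n" using elim by (simp add: field_simps)
      also have "(2 * real n + c + 1) / real n = 2 + (c + 1) / real n"
        using elim by (simp add: field_simps)
      finally show ?case by simp
    qed
    ultimately show ?thesis
      by (auto intro: Lim_transform_eventually)
  qed
  have "(\<lambda>n. Gamma_series c n / (Gamma_series a n * Gamma_series b n)) \<longlonglongrightarrow> Gamma c / (Gamma a * Gamma b)"
    using Gamma_real_pos[OF pos(1)] Gamma_real_pos[OF pos(2)]
    by (intro tendsto_divide tendsto_mult Gamma_series_LIMSEQ) auto
  note lim = tendsto_mult[OF tendsto_mult[OF tendsto_const[of "2 powr (\<alpha> + \<beta> + 1)"] frac]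
    tendsto_mult[OF tendsto_const[of "Gamma a * Gamma b / Gamma c"] this]]
  have eq: "2 powr (\<alpha> + \<beta> + 1) * (1 / 2)
      * (Gamma a * Gamma b / Gamma c * (Gamma c / (Gamma a * Gamma b))) = 2 powr (\<alpha> + \<beta>)"
    using Gamma_real_pos[OF pos(1)] Gamma_real_pos[OF pos(2)] Gamma_real_pos[OF pos(3)]
    by (simp add: powr_add)
  have "\<forall>\<^sub>F n in sequentially. 2 powr (\<alpha> + \<beta> + 1) * ((real n + c) / (2 * real n + c + 1))
      * (Gamma a * Gamma b / Gamma c * (Gamma_series c n / (Gamma_series a n * Gamma_series b n)))
    = real (Suc n) * jacobi_sigma \<alpha> \<beta> (Suc n)"
    using eventually_gt_at_top[of 0]
  proof eventually_elim
    case (elim n)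
    \<comment> \<open>\<open>F\<close> stands for \<open>fact n\<close>, and \<open>ea\<close>,
      \<open>eb\<close> stand for \<open>n powr a\<close>, \<open>n powr b\<close>; their product
      replaces \<open>n powr c\<close>.\<close>
    have alg: "(ga * F * ea / sa) * (gb * F * eb / sb) / (N * F * (gc * F * (ea * eb) / sc))
        = ga * gb / gc * (sc / (sa * sb)) / N"
      if "N > 0" "F > 0" "ea > 0" "eb > 0" "gc > 0" "sa > 0" "sb > 0" "sc > 0"
      for N ga gb gc F ea eb sa sb sc :: real
      using that by (simp add: field_simps)
    have shift:
      "Gamma (real n + \<alpha> + 2) = Gamma a * fact n * exp (a * ln (real n)) / Gamma_series a n"
      "Gamma (real n + \<beta> + 2) = Gamma b * fact n * exp (b * ln (real n)) / Gamma_series b n"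
      "Gamma (real n + \<alpha> + \<beta> + 3)
        = Gamma c * fact n * (exp (a * ln (real n)) * exp (b * ln (real n))) / Gamma_series c n"
      using Gamma_shift[OF pos(1), of n] Gamma_shift[OF pos(2), of n] Gamma_shift[OF pos(3), of n]
      by (simp_all add: a_def b_def c_def exp_add[symmetric] algebra_simps)
    have fact_eq: "fact (Suc n) = (real n + 1) * fact n" by simp
    have series_pos: "Gamma_series z n > 0" if "z > 0" for z :: real
      using that by (auto simp: Gamma_series_def intro!: divide_pos_pos pochhammer_pos)
    have "Gamma (real n + \<alpha> + 2) * Gamma (real n + \<beta> + 2)
          / (fact (Suc n) * Gamma (real n + \<alpha> + \<beta> + 3))
        = Gamma a * Gamma b / Gamma c * (Gamma_series c n / (Gamma_series a n * Gamma_series b n)) / (real n + 1)"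
      unfolding shift fact_eq using series_pos pos Gamma_real_pos by (intro alg) auto
    then show ?case
      unfolding jacobi_sigma_Suc_Gamma[OF assms] by (simp add: c_def add_ac)
  qed
  from Lim_transform_eventually[OF lim this] show ?thesis
    unfolding eq by (rule LIMSEQ_imp_Suc)
qed

text \<open>\<open>jacobi_sigma_Suc\<close> is read backwards \<open>k\<close> times; each inverse
  factor \<open>4 * (n + 1) / (n + \<alpha> + \<beta> + 2)\<close> is bounded in
  \<open>n\<close>.\<close>

lemma jacobi_sigma_raise_le:
  assumes "\<alpha> > -1" "\<beta> > -1"
  obtains C where "C > 0"
    "\<And>n. jacobi_sigma (\<alpha> + real k) (\<beta> + real k) n \<le> C * jacobi_sigma \<alpha> \<beta> (n + k)"
proof -
  have "\<exists>C>0. \<forall>n. jacobi_sigma (\<alpha> + real k) (\<beta> + real k) n \<le> C * jacobi_sigma \<alpha> \<beta> (n + k)"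
    using assms
  proof (induction k arbitrary: \<alpha> \<beta>)
    case 0
    then show ?case by (auto intro!: exI[of _ 1])
  next
    case (Suc k)
    have "\<alpha> + 1 > -1" "\<beta> + 1 > -1" using Suc.prems by auto
    from Suc.IH[OF this] obtain C where C: "C > 0"
      "\<And>n. jacobi_sigma (\<alpha> + 1 + real k) (\<beta> + 1 + real k) n \<le> C * jacobi_sigma (\<alpha> + 1) (\<beta> + 1) (n + k)"
      by blast
    \<comment> \<open>The quotient \<open>(n + 1) / (n + c)\<close> with \<open>c > 0\<close> is at
      most \<open>1\<close> if \<open>c \<ge> 1\<close> and at most its value \<open>1 / c\<close>
      at \<open>n = 0\<close> otherwise.\<close>
    define M where "M = 4 * max 1 (1 / (\<alpha> + \<beta> + 2))"
    have M: "jacobi_sigma (\<alpha> + 1) (\<beta> + 1) n \<le> M * jacobi_sigma \<alpha> \<beta> (Suc n)" for n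
    proof -
      have p: "\<alpha> + \<beta> + 2 > 0" using Suc.prems by simp
      have "1 \<le> max 1 (1 / (\<alpha> + \<beta> + 2)) * (\<alpha> + \<beta> + 2)"
        using mult_right_mono[OF max.cobounded2[of "1 / (\<alpha> + \<beta> + 2)" 1], of "\<alpha> + \<beta> + 2"] p
        by simp
      moreover have "real n \<le> max 1 (1 / (\<alpha> + \<beta> + 2)) * real n"
        by (simp add: mult_le_cancel_right1)
      ultimately have "real n + 1 \<le> max 1 (1 / (\<alpha> + \<beta> + 2)) * (real n + \<alpha> + \<beta> + 2)"
        by (simp add: algebra_simps)
      then have "1 \<le> M * ((real n + \<alpha> + \<beta> + 2) / (4 * (real n + 1)))"
        by (simp add: M_def field_simps)
      from mult_right_mono[OF this jacobi_sigma_nonneg]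
      show ?thesis using Suc.prems by (simp add: jacobi_sigma_Suc mult.assoc)
    qed
    have "jacobi_sigma (\<alpha> + real (Suc k)) (\<beta> + real (Suc k)) n \<le> C * M * jacobi_sigma \<alpha> \<beta> (n + Suc k)" for n
      using order.trans[OF C(2)[of n] mult_left_mono[OF M[of "n + k"]]] C(1) by (simp add: add.commute add.left_commute mult.assoc)
    moreover have "C * M > 0" using C(1) by (simp add: M_def)
    ultimately show ?case by blast
  qed
  then show thesis using that by blast
qed

section \<open>Interior bounds by an energy argument\<close>

text \<open>Gronwall's argument in both directions: \<open>exp (M * t) * E t\<close> is
  nondecreasing and \<open>exp (- (M * t)) * E t\<close> is nonincreasing. Values at any two points
  of the interval are thus comparable.\<close>

lemma exp_growth_comparison:
  fixes E E' :: "real \<Rightarrow> real"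
  assumes deriv: "\<And>t. t \<in> {c..d} \<Longrightarrow> (E has_real_derivative E' t) (at t)"
    and bound: "\<And>t. t \<in> {c..d} \<Longrightarrow> \<bar>E' t\<bar> \<le> M * E t"
    and "M \<ge> 0" and nonneg: "\<And>t. t \<in> {c..d} \<Longrightarrow> E t \<ge> 0"
    and x: "x \<in> {c..d}" and y: "y \<in> {c..d}"
  shows "exp (- M * (d - c)) * E x \<le> E y"
proof -
  have le: "exp (- M * (d - c)) \<le> exp (- (M * u))" if "u \<le> d - c" for u
    using that \<open>M \<ge> 0\<close> by (simp add: mult_left_mono)
  show ?thesis
  proof (cases "x \<le> y")
    case True
    have "exp (M * x) * E x \<le> exp (M * y) * E y"
    proof (rule DERIV_nonneg_imp_nondecreasing[where f = "\<lambda>t. exp (M * t) * E t", OF True])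
      fix t assume "x \<le> t" "t \<le> y"
      then have t: "t \<in> {c..d}" using x y by auto
      have "((\<lambda>t. exp (M * t) * E t) has_real_derivative exp (M * t) * (M * E t + E' t)) (at t)"
        using deriv[OF t] by (auto intro!: derivative_eq_intros simp: algebra_simps)
      moreover have "exp (M * t) * (M * E t + E' t) \<ge> 0" using bound[OF t] by simp
      ultimately show "\<exists>D. ((\<lambda>t. exp (M * t) * E t) has_real_derivative D) (at t) \<and> D \<ge> 0" by blast
    qed
    then have "exp (- (M * (y - x))) * E x \<le> E y"
      by (simp add: right_diff_distrib exp_diff exp_minus field_simps)
    then show ?thesis using mult_right_mono[OF le[of "y - x"] nonneg[OF x]] x y by auto
  next
    case False
    have "exp (- (M * x)) * E x \<le> exp (- (M * y)) * E y"
    proof (rule DERIV_nonpos_imp_nonincreasing[where f = "\<lambda>t. exp (- (M * t)) * E t" and a = y and b = x])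
      fix t assume "y \<le> t" "t \<le> x"
      then have t: "t \<in> {c..d}" using x y by auto
      have "((\<lambda>t. exp (- (M * t)) * E t) has_real_derivative exp (- (M * t)) * (E' t - M * E t)) (at t)"
        using deriv[OF t] by (auto intro!: derivative_eq_intros simp: algebra_simps)
      moreover have "exp (- (M * t)) * (E' t - M * E t) \<le> 0"
        using bound[OF t] by (simp add: mult_le_0_iff)
      ultimately show "\<exists>D. ((\<lambda>t. exp (- (M * t)) * E t) has_real_derivative D) (at t) \<and> D \<le> 0" by blast
    qed (use False in simp)
    then have "exp (- (M * (x - y))) * E x \<le> E y"
      by (simp add: right_diff_distrib exp_diff exp_minus field_simps)
    then show ?thesis using mult_right_mono[OF le[of "x - y"] nonneg[OF x]] x y by auto
  qed
qed

text \<open>The constant \<open>\<kappa>\<close> serves twice. The derivative of the polynomial of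
  degree \<open>Suc n\<close> is \<open>2 * (n + 1) * \<kappa>\<close> times the raised one, which
  cancels the mixed products in the derivative of \<open>E\<close>; and \<open>\<kappa>\<close> is
  the ratio of norms in \<open>jacobi_sigma_Suc\<close>, so both parts of \<open>E\<close> have the
  same weighted integral.\<close>

lemma jacobi_P_energy:
  fixes \<alpha> \<beta> :: real and n :: nat
  defines "\<kappa> \<equiv> (real n + \<alpha> + \<beta> + 2) / (4 * (real n + 1))"
  defines "E \<equiv> \<lambda>x. (jacobi_P \<alpha> \<beta> (Suc n) x)\<^sup>2 + \<kappa> * (1 - x\<^sup>2) * (jacobi_P (\<alpha> + 1) (\<beta> + 1) n x)\<^sup>2"
  shows has_real_derivative_jacobi_P_energy:
      "(E has_real_derivative
         - 2 * \<kappa> * (x + (\<beta> + 1) * (1 - x) - (\<alpha> + 1) * (1 + x)) * (jacobi_P (\<alpha> + 1) (\<beta> + 1) n x)\<^sup>2) (at x)"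
    and has_integral_jacobi_P_energy:
      "\<alpha> > -1 \<Longrightarrow> \<beta> > -1 \<Longrightarrow>
         ((\<lambda>x. jacobi_weight \<alpha> \<beta> x * E x) has_integral 2 * jacobi_sigma \<alpha> \<beta> (Suc n)) {-1..1}"
proof -
  let ?P = "jacobi_P \<alpha> \<beta> (Suc n)" and ?R = "jacobi_P (\<alpha> + 1) (\<beta> + 1) n"
  obtain R' where R': "(?R has_real_derivative R') (at x)"
    using jacobi_P_differentiable by blast
  have P': "(?P has_real_derivative 2 * (real n + 1) * \<kappa> * ?R x) (at x)"
  proof -
    have "2 * u * (X / (4 * u)) = X / 2" if "u > 0" for u X :: real using that by simp
    from this[of "real n + 1"] show ?thesis
      using has_real_derivative_jacobi_P[of \<alpha> \<beta> n x] by (simp only: \<kappa>_def)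
  qed
  have "(E has_real_derivative 2 * ?P x * (2 * (real n + 1) * \<kappa> * ?R x)
      + (\<kappa> * (- 2 * x) * (?R x)\<^sup>2 + \<kappa> * (1 - x\<^sup>2) * (2 * ?R x * R'))) (at x)"
    unfolding E_def using P' R' by (auto intro!: derivative_eq_intros simp: algebra_simps)
  moreover have "2 * ?P x * (2 * (real n + 1) * \<kappa> * ?R x)
      + (\<kappa> * (- 2 * x) * (?R x)\<^sup>2 + \<kappa> * (1 - x\<^sup>2) * (2 * ?R x * R'))
    = - 2 * \<kappa> * (x + (\<beta> + 1) * (1 - x) - (\<alpha> + 1) * (1 + x)) * (?R x)\<^sup>2"
  proof -
    \<comment> \<open>The derivative \<open>R'\<close> enters only multiplied by
      \<open>1 - x\<^sup>2\<close>, so it can be eliminated without a second-order differential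
      equation.\<close>
    have "(1 - x\<^sup>2) * R' = - 2 * (real n + 1) * ?P x - ((\<beta> + 1) * (1 - x) - (\<alpha> + 1) * (1 + x)) * ?R x"
      using jacobi_P_raise[OF R'] by linarith
    then have "\<kappa> * (1 - x\<^sup>2) * (2 * ?R x * R') = 2 * \<kappa> * ?R x *
        (- 2 * (real n + 1) * ?P x - ((\<beta> + 1) * (1 - x) - (\<alpha> + 1) * (1 + x)) * ?R x)"
      by (simp add: mult_ac)
    then show ?thesis by (simp only:) (simp add: power2_eq_square algebra_simps)
  qed
  ultimately show "(E has_real_derivative
      - 2 * \<kappa> * (x + (\<beta> + 1) * (1 - x) - (\<alpha> + 1) * (1 + x)) * (?R x)\<^sup>2) (at x)"
    by (rule DERIV_cong)
next
  assume ab: "\<alpha> > -1" "\<beta> > -1"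
  have "((\<lambda>x. jacobi_weight \<alpha> \<beta> x * (jacobi_P \<alpha> \<beta> (Suc n) x)\<^sup>2
      + \<kappa> * (jacobi_weight (\<alpha> + 1) (\<beta> + 1) x * (jacobi_P (\<alpha> + 1) (\<beta> + 1) n x)\<^sup>2))
    has_integral jacobi_sigma \<alpha> \<beta> (Suc n) + \<kappa> * jacobi_sigma (\<alpha> + 1) (\<beta> + 1) n) {-1..1}"
    using ab by (intro has_integral_add has_integral_mult_right has_integral_jacobi_sigma) auto
  moreover have "jacobi_sigma \<alpha> \<beta> (Suc n) + \<kappa> * jacobi_sigma (\<alpha> + 1) (\<beta> + 1) n
      = 2 * jacobi_sigma \<alpha> \<beta> (Suc n)"
    using jacobi_sigma_Suc[OF ab] by (simp add: \<kappa>_def)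
  ultimately show "((\<lambda>x. jacobi_weight \<alpha> \<beta> x * E x) has_integral 2 * jacobi_sigma \<alpha> \<beta> (Suc n)) {-1..1}"
  proof (subst has_integral_cong)
    fix x :: real assume "x \<in> {-1..1}"
    then show "jacobi_weight \<alpha> \<beta> x * E x = jacobi_weight \<alpha> \<beta> x * (jacobi_P \<alpha> \<beta> (Suc n) x)\<^sup>2
        + \<kappa> * (jacobi_weight (\<alpha> + 1) (\<beta> + 1) x * (jacobi_P (\<alpha> + 1) (\<beta> + 1) n x)\<^sup>2)"
      by (simp add: E_def jacobi_weight_Suc) (simp add: algebra_simps)
  qed simp
qed

text \<open>A pointwise value of the energy is at most a constant times the energy at every other
  point of \<open>{c..d}\<close>. Averaging over these points against the weight, which is bounded
  below there, bounds it by the full weighted integral.\<close>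

lemma jacobi_P_interior_bound:
  assumes ab: "\<alpha> > -1" "\<beta> > -1" and cd: "-1 < c" "c < d" "d < 1"
  obtains C where "C > 0"
    "\<And>n x. x \<in> {c..d} \<Longrightarrow> (jacobi_P \<alpha> \<beta> (Suc n) x)\<^sup>2 \<le> C * jacobi_sigma \<alpha> \<beta> (Suc n)"
proof -
  \<comment> \<open>On an interval, \<open>1 - x\<^sup>2\<close> attains its minimum at an
    endpoint.\<close>
  define m where "m = min (1 - c\<^sup>2) (1 - d\<^sup>2)"
  have m: "m > 0" using cd by (auto simp: m_def abs_square_less_1 abs_less_iff)
  have m_le: "m \<le> 1 - x\<^sup>2" if "x \<in> {c..d}" for x
  proof -
    have "x\<^sup>2 \<le> max (c\<^sup>2) (d\<^sup>2)"
    proof (cases "x \<ge> 0")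
      case True
      then have "x\<^sup>2 \<le> d\<^sup>2" using that by (intro power_mono) auto
      then show ?thesis by simp
    next
      case False
      then have "(- x)\<^sup>2 \<le> (- c)\<^sup>2" using that by (intro power_mono) auto
      then show ?thesis by simp
    qed
    then show ?thesis by (auto simp: m_def max_def min_def split: if_splits)
  qed
  \<comment> \<open>The numerator bounds twice the linear factor \<open>l\<close> of the energy
    derivative. Since \<open>\<kappa>\<close> multiplies both that derivative and the second part of
    \<open>E\<close>, it drops out and \<open>M\<close> does not depend on \<open>n\<close>.\<close>
  define M where "M = 2 * (1 + 2 * (\<alpha> + 1) + 2 * (\<beta> + 1)) / m"
  have M: "M \<ge> 0" using ab m by (simp add: M_def)
  have "\<exists>x0\<in>{c..d}. \<forall>y\<in>{c..d}. jacobi_weight \<alpha> \<beta> x0 \<le> jacobi_weight \<alpha> \<beta> y"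
    unfolding jacobi_weight_def using cd
    by (intro continuous_attains_inf continuous_on_mult continuous_on_powr continuous_intros) auto
  then obtain x0 where x0: "x0 \<in> {c..d}"
    "\<And>y. y \<in> {c..d} \<Longrightarrow> jacobi_weight \<alpha> \<beta> x0 \<le> jacobi_weight \<alpha> \<beta> y" by blast
  define w0 where "w0 = jacobi_weight \<alpha> \<beta> x0"
  have w0: "w0 > 0" "\<And>y. y \<in> {c..d} \<Longrightarrow> w0 \<le> jacobi_weight \<alpha> \<beta> y"
    using x0 cd by (auto simp: w0_def jacobi_weight_def)
  define e where "e = exp (- M * (d - c))"
  define C where "C = 2 / (w0 * e * (d - c))"
  have e: "e > 0" by (simp add: e_def)
  show thesis
  proof (rule that[of C])
    show "C > 0" using w0(1) e cd by (simp add: C_def)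
    fix n x assume x: "x \<in> {c..d}"
    define \<kappa> where "\<kappa> = (real n + \<alpha> + \<beta> + 2) / (4 * (real n + 1))"
    define R where "R = jacobi_P (\<alpha> + 1) (\<beta> + 1) n"
    define E where "E = (\<lambda>x. (jacobi_P \<alpha> \<beta> (Suc n) x)\<^sup>2 + \<kappa> * (1 - x\<^sup>2) * (R x)\<^sup>2)"
    have \<kappa>: "\<kappa> > 0" using ab by (simp add: \<kappa>_def)
    have E_nonneg: "E t \<ge> 0" if "t \<in> {-1..1}" for t
      using that \<kappa> by (auto simp: E_def abs_square_le_1 intro!: add_nonneg_nonneg mult_nonneg_nonneg)
    have sub: "{c..d} \<subseteq> {-1..1}" using cd by auto
    have compare: "e * E x \<le> E y" if y: "y \<in> {c..d}" for y
      unfolding e_def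
    proof (rule exp_growth_comparison[OF _ _ M _ x y])
      fix t assume t: "t \<in> {c..d}"
      define l where "l = t + (\<beta> + 1) * (1 - t) - (\<alpha> + 1) * (1 + t)"
      show "(E has_real_derivative - 2 * \<kappa> * l * (R t)\<^sup>2) (at t)"
        unfolding E_def \<kappa>_def R_def l_def by (rule has_real_derivative_jacobi_P_energy)
      have "\<bar>(\<beta> + 1) * (1 - t)\<bar> \<le> (\<beta> + 1) * 2" "\<bar>(\<alpha> + 1) * (1 + t)\<bar> \<le> (\<alpha> + 1) * 2"
        using t ab cd mult_left_mono[of "1 - t" 2 "\<beta> + 1"] mult_left_mono[of "1 + t" 2 "\<alpha> + 1"]
        by (auto simp: abs_mult)
      then have "\<bar>l\<bar> \<le> 1 + 2 * (\<alpha> + 1) + 2 * (\<beta> + 1)"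
        using t cd unfolding l_def by auto
      then have "2 * \<bar>l\<bar> \<le> M * m" using m by (simp add: M_def)
      also have "\<dots> \<le> M * (1 - t\<^sup>2)" using m_le[OF t] M by (rule mult_left_mono)
      finally have "2 * \<bar>l\<bar> * (\<kappa> * (R t)\<^sup>2) \<le> M * (1 - t\<^sup>2) * (\<kappa> * (R t)\<^sup>2)"
        using \<kappa> by (intro mult_right_mono) auto
      also have "\<dots> = M * (\<kappa> * (1 - t\<^sup>2) * (R t)\<^sup>2)" by (simp add: mult_ac)
      also have "\<dots> \<le> M * E t" using M by (intro mult_left_mono) (auto simp: E_def)
      finally show "\<bar>- 2 * \<kappa> * l * (R t)\<^sup>2\<bar> \<le> M * E t"
        using \<kappa> by (simp add: abs_mult mult_ac)
      show "E t \<ge> 0" using t sub by (intro E_nonneg) auto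
    qed
    have int: "((\<lambda>y. jacobi_weight \<alpha> \<beta> y * E y) has_integral 2 * jacobi_sigma \<alpha> \<beta> (Suc n)) {-1..1}"
      unfolding E_def \<kappa>_def R_def by (rule has_integral_jacobi_P_energy[OF ab])
    then have int': "(\<lambda>y. jacobi_weight \<alpha> \<beta> y * E y) integrable_on {c..d}"
      using sub by (intro integrable_on_subinterval) (auto simp: has_integral_iff)
    \<comment> \<open>The comparison of \<open>E x\<close> with \<open>E y\<close> is integrated
      over \<open>y\<close>, with \<open>x\<close> fixed.\<close>
    have "w0 * (e * E x) * (d - c) = integral {c..d} (\<lambda>_. w0 * (e * E x))"
      using cd by simp
    also have "\<dots> \<le> integral {c..d} (\<lambda>y. jacobi_weight \<alpha> \<beta> y * E y)"
    proof (rule integral_le[OF _ int'])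
      fix y assume y: "y \<in> {c..d}"
      show "w0 * (e * E x) \<le> jacobi_weight \<alpha> \<beta> y * E y"
        using w0(1) w0(2)[OF y] compare[OF y] E_nonneg[of x] x sub e
        by (intro mult_mono) auto
    qed (rule integrable_const_ivl)
    also have "\<dots> \<le> integral {-1..1} (\<lambda>y. jacobi_weight \<alpha> \<beta> y * E y)"
      using int int' E_nonneg sub by (intro integral_subset_le) (auto simp: has_integral_iff)
    also have "\<dots> = 2 * jacobi_sigma \<alpha> \<beta> (Suc n)" using int by (rule integral_unique)
    finally have "E x \<le> C * jacobi_sigma \<alpha> \<beta> (Suc n)"
      using w0(1) e cd by (simp add: C_def field_simps)
    moreover have "(jacobi_P \<alpha> \<beta> (Suc n) x)\<^sup>2 \<le> E x"
      using \<kappa> x sub m m_le[OF x] by (auto simp: E_def intro!: mult_nonneg_nonneg)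
    ultimately show "(jacobi_P \<alpha> \<beta> (Suc n) x)\<^sup>2 \<le> C * jacobi_sigma \<alpha> \<beta> (Suc n)" by linarith
  qed
qed

section \<open>Derivatives of a logarithmic singularity\<close>

lemma has_real_derivative_abs_diff:
  fixes x z :: real
  assumes "x \<noteq> z"
  shows "((\<lambda>x. \<bar>x - z\<bar>) has_real_derivative sgn (x - z)) (at x within S)"
proof -
  have "((\<lambda>y. sgn (x - z) * (y - z)) has_real_derivative sgn (x - z)) (at x)"
    by (auto intro!: derivative_eq_intros)
  moreover have "\<forall>\<^sub>F y in nhds x. sgn (x - z) * (y - z) = \<bar>y - z\<bar>"
  proof (cases "x > z")
    case True
    then have "\<forall>\<^sub>F y in nhds x. y \<in> {z<..}" by (intro eventually_nhds_in_open) auto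
    then show ?thesis by eventually_elim (use True in auto)
  next
    case False
    then have "\<forall>\<^sub>F y in nhds x. y \<in> {..<z}" using assms by (intro eventually_nhds_in_open) auto
    then show ?thesis by eventually_elim (use False assms in auto)
  qed
  ultimately have "((\<lambda>x. \<bar>x - z\<bar>) has_real_derivative sgn (x - z)) (at x)"
    by (subst (asm) DERIV_cong_ev[OF refl _ refl]) auto
  then show ?thesis by (rule has_field_derivative_at_within)
qed

text \<open>Dividing by \<open>x - z\<close>, rather than lowering the exponent, carries the sign,
  so one formula serves both sides of \<open>z\<close>.\<close>

lemma has_real_derivative_abs_powr:
  fixes x z p :: real
  assumes "x \<noteq> z"
  shows "((\<lambda>x. \<bar>x - z\<bar> powr p) has_real_derivative p * \<bar>x - z\<bar> powr p / (x - z)) (at x within S)"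
proof -
  have "((\<lambda>x. \<bar>x - z\<bar>) has_real_derivative sgn (x - z)) (at x)"
    using assms by (rule has_real_derivative_abs_diff)
  from DERIV_fun_powr[OF this, of p] have
    "((\<lambda>x. \<bar>x - z\<bar> powr p) has_real_derivative p * \<bar>x - z\<bar> powr (p - 1) * sgn (x - z)) (at x)"
    using assms by simp
  moreover have "p * \<bar>x - z\<bar> powr (p - 1) * sgn (x - z) = p * \<bar>x - z\<bar> powr p / (x - z)"
    using assms by (auto simp: powr_diff sgn_if field_simps)
  ultimately show ?thesis by (metis has_field_derivative_at_within)
qed

lemma has_real_derivative_ln_abs:
  fixes x z :: real
  assumes "x \<noteq> z"
  shows "((\<lambda>x. ln \<bar>x - z\<bar>) has_real_derivative 1 / (x - z)) (at x within S)"
proof -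
  have "((\<lambda>x. ln \<bar>x - z\<bar>) has_real_derivative sgn (x - z) / \<bar>x - z\<bar>) (at x)"
    using assms DERIV_chain2[OF DERIV_ln_divide has_real_derivative_abs_diff[OF assms]] by simp
  moreover have "sgn (x - z) / \<bar>x - z\<bar> = 1 / (x - z)"
    using assms by (cases "x > z") (auto simp: sgn_if divide_simps)
  ultimately show ?thesis by (metis has_field_derivative_at_within)
qed

text \<open>
  For \<open>t \<noteq> 0\<close> the \<open>k\<close>-th derivative of \<open>\<bar>t\<bar> powr s * ln \<bar>t\<bar> ^ \<mu>\<close> is
  \<open>\<bar>t\<bar> powr s * poly (log_poly s \<mu> k) (ln \<bar>t\<bar>) / t ^ k\<close>.
\<close>
primrec log_poly :: "real \<Rightarrow> nat \<Rightarrow> nat \<Rightarrow> real poly" where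
  "log_poly s \<mu> 0 = monom 1 \<mu>"
| "log_poly s \<mu> (Suc k) = smult (s - real k) (log_poly s \<mu> k) + pderiv (log_poly s \<mu> k)"

lemma degree_log_poly: "degree (log_poly s \<mu> k) \<le> \<mu>"
proof (induction k)
  case (Suc k)
  then show ?case
    by (auto intro!: degree_add_le order.trans[OF degree_smult_le] simp: degree_pderiv)
qed (simp add: degree_monom_le)

definition log_power :: "real \<Rightarrow> nat \<Rightarrow> nat \<Rightarrow> real \<Rightarrow> real" where
  "log_power s \<mu> k t = \<bar>t\<bar> powr s * poly (log_poly s \<mu> k) (ln \<bar>t\<bar>) / t ^ k"

lemma has_real_derivative_log_power:
  assumes "x \<noteq> z"
  shows "((\<lambda>x. log_power s \<mu> k (x - z)) has_real_derivative log_power s \<mu> (Suc k) (x - z)) (at x within S)"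
proof -
  let ?p = "log_poly s \<mu> k" and ?t = "x - z"
  have "((\<lambda>x. poly ?p (ln \<bar>x - z\<bar>)) has_real_derivative poly (pderiv ?p) (ln \<bar>?t\<bar>) * (1 / ?t)) (at x within S)"
    by (rule DERIV_chain2[OF poly_DERIV has_real_derivative_ln_abs[OF assms]])
  moreover have "((\<lambda>x. inverse ((x - z) ^ k)) has_real_derivative - real k / ?t ^ Suc k) (at x within S)"
  proof (cases k)
    case (Suc m)
    have "((\<lambda>x. inverse ((x - z) ^ k)) has_real_derivative
        - (inverse (?t ^ k) * (real k * ?t ^ (k - 1)) * inverse (?t ^ k))) (at x within S)"
      using assms by (auto intro!: derivative_eq_intros)
    moreover have "- (inverse (u ^ k) * (real k * u ^ (k - 1)) * inverse (u ^ k)) = - real k / u ^ Suc k"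
      if "u \<noteq> 0" for u :: real
      using that Suc by (simp add: field_simps)
    ultimately show ?thesis using assms by simp
  qed simp
  ultimately have "((\<lambda>x. \<bar>x - z\<bar> powr s * poly ?p (ln \<bar>x - z\<bar>) * inverse ((x - z) ^ k)) has_real_derivative
      (s * \<bar>?t\<bar> powr s / ?t * poly ?p (ln \<bar>?t\<bar>) + poly (pderiv ?p) (ln \<bar>?t\<bar>) * (1 / ?t) * \<bar>?t\<bar> powr s)
        * inverse (?t ^ k)
      + (- real k / ?t ^ Suc k) * (\<bar>?t\<bar> powr s * poly ?p (ln \<bar>?t\<bar>))) (at x within S)"
    by (intro DERIV_mult has_real_derivative_abs_powr assms)
  moreover have "(s * A / u * P + Q * (1 / u) * A) * inverse (u ^ k) + (- real k / u ^ Suc k) * (A * P)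
      = A * ((s - real k) * P + Q) / u ^ Suc k" if "u \<noteq> 0" for A P Q u :: real
    using that by (simp add: field_simps)
  ultimately show ?thesis
    using assms by (simp add: log_power_def divide_inverse)
qed

text \<open>The polynomial in the logarithm has degree at most \<open>\<mu>\<close>. The base
  \<open>1 + \<bar>ln \<bar>t\<bar>\<bar>\<close> is at least \<open>1\<close>, so its
  \<open>\<mu>\<close>-th power dominates every lower power, also near
  \<open>\<bar>t\<bar> = 1\<close> where the logarithm vanishes.\<close>

lemma abs_log_power_le:
  obtains C where "C \<ge> 0"
    "\<And>t. t \<noteq> 0 \<Longrightarrow> \<bar>log_power s \<mu> k t\<bar> \<le> C * \<bar>t\<bar> powr (s - real k) * (1 + \<bar>ln \<bar>t\<bar>\<bar>) ^ \<mu>"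
proof (rule that)
  let ?p = "log_poly s \<mu> k"
  let ?C = "\<Sum>i\<le>degree ?p. \<bar>coeff ?p i\<bar>"
  show "?C \<ge> 0" by (intro sum_nonneg) auto
  fix t :: real assume t: "t \<noteq> 0"
  define L where "L = ln \<bar>t\<bar>"
  have "\<bar>poly ?p L\<bar> \<le> (\<Sum>i\<le>degree ?p. \<bar>coeff ?p i\<bar> * \<bar>L\<bar> ^ i)"
    unfolding poly_altdef by (rule order.trans[OF sum_abs]) (simp add: abs_mult power_abs)
  also have "\<dots> \<le> (\<Sum>i\<le>degree ?p. \<bar>coeff ?p i\<bar> * (1 + \<bar>L\<bar>) ^ \<mu>)"
  proof (intro sum_mono mult_left_mono)
    fix i assume "i \<in> {..degree ?p}"
    then have "i \<le> \<mu>" using degree_log_poly[of s \<mu> k] by simp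
    have "\<bar>L\<bar> ^ i \<le> (1 + \<bar>L\<bar>) ^ i" by (intro power_mono) auto
    also have "\<dots> \<le> (1 + \<bar>L\<bar>) ^ \<mu>" using \<open>i \<le> \<mu>\<close> by (intro power_increasing) auto
    finally show "\<bar>L\<bar> ^ i \<le> (1 + \<bar>L\<bar>) ^ \<mu>" .
  qed simp
  also have "\<dots> = ?C * (1 + \<bar>L\<bar>) ^ \<mu>" by (simp add: sum_distrib_right)
  finally have "\<bar>t\<bar> powr (s - real k) * \<bar>poly ?p L\<bar> \<le> \<bar>t\<bar> powr (s - real k) * (?C * (1 + \<bar>L\<bar>) ^ \<mu>)"
    by (rule mult_left_mono) simp
  moreover have "\<bar>log_power s \<mu> k t\<bar> = \<bar>t\<bar> powr (s - real k) * \<bar>poly ?p L\<bar>"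
    using t by (simp add: log_power_def L_def abs_mult power_abs powr_diff powr_realpow)
  ultimately show "\<bar>log_power s \<mu> k t\<bar> \<le> ?C * \<bar>t\<bar> powr (s - real k) * (1 + \<bar>ln \<bar>t\<bar>\<bar>) ^ \<mu>"
    by (simp add: L_def mult_ac)
qed

lemma Leibniz_has_real_derivative:
  fixes u v :: "nat \<Rightarrow> real \<Rightarrow> real"
  assumes "\<And>k. (u k has_real_derivative u (Suc k) x) (at x within S)"
    and "\<And>k. (v k has_real_derivative v (Suc k) x) (at x within S)"
  shows "((\<lambda>x. \<Sum>j\<le>k. real (k choose j) * u j x * v (k - j) x) has_real_derivative
           (\<Sum>j\<le>Suc k. real (Suc k choose j) * u j x * v (Suc k - j) x)) (at x within S)"
proof -
  have "((\<lambda>x. \<Sum>j\<le>k. real (k choose j) * u j x * v (k - j) x) has_real_derivative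
      (\<Sum>j\<le>k. real (k choose j) * u (Suc j) x * v (k - j) x + real (k choose j) * u j x * v (Suc (k - j)) x))
      (at x within S)"
    using assms by (auto intro!: derivative_eq_intros sum.cong)
  moreover have "(\<Sum>j\<le>k. real (k choose j) * u (Suc j) x * v (k - j) x + real (k choose j) * u j x * v (Suc (k - j)) x)
      = (\<Sum>j\<le>Suc k. real (Suc k choose j) * u j x * v (Suc k - j) x)"
  proof -
    \<comment> \<open>The additional summand \<open>j = Suc k\<close> has binomial coefficient
      \<open>0\<close>; Pascal's rule then merges the two sums.\<close>
    have "(\<Sum>j\<le>k. real (k choose j) * u j x * v (Suc (k - j)) x)
        = (\<Sum>j\<le>Suc k. real (k choose j) * u j x * v (Suc k - j) x)"
      by (simp add: Suc_diff_le)
    then show ?thesis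
      unfolding sum.distrib sum.atMost_Suc_shift
      by (simp add: sum.distrib[symmetric] algebra_simps)
  qed
  ultimately show ?thesis by (rule DERIV_cong)
qed

text \<open>By the Leibniz rule every derivative is a sum of derivatives of the singular factor
  times bounded derivatives of \<open>g\<close>. The term in which the singular factor is
  differentiated \<open>k\<close> times is the most singular one and dictates the exponent
  \<open>s - k\<close>.\<close>

lemma log_singular_derivatives:
  fixes g :: "real \<Rightarrow> real"
  assumes "smooth_on_Icc a b g" and z: "z \<in> {a..b}"
  obtains F C where
    "\<And>x. x \<in> {a..b} \<Longrightarrow> F 0 x = \<bar>x - z\<bar> powr s * ln \<bar>x - z\<bar> ^ \<mu> * g x"
    "\<And>k x. x \<in> {a..b} \<Longrightarrow> x \<noteq> z \<Longrightarrow>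
       (F k has_real_derivative F (Suc k) x) (at x within {a..b})"
    "\<And>k. C k \<ge> 0"
    "\<And>k x. x \<in> {a..b} \<Longrightarrow> x \<noteq> z \<Longrightarrow>
       \<bar>F k x\<bar> \<le> C k * \<bar>x - z\<bar> powr (s - real k) * (1 + \<bar>ln \<bar>x - z\<bar>\<bar>) ^ \<mu>"
proof -
  obtain D where D0: "\<And>x. x \<in> {a..b} \<Longrightarrow> D 0 x = g x"
    and D: "\<And>k x. x \<in> {a..b} \<Longrightarrow> (D k has_real_derivative D (Suc k) x) (at x within {a..b})"
    using assms(1) unfolding smooth_on_Icc_def by blast
  have "\<exists>M. M \<ge> 0 \<and> (\<forall>x\<in>{a..b}. \<bar>D k x\<bar> \<le> M)" for k
  proof -
    have "continuous_on {a..b} (D k)" by (rule DERIV_continuous_on) (rule D)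
    then have "bounded (D k ` {a..b})"
      by (intro compact_imp_bounded compact_continuous_image) auto
    then obtain M where "\<forall>y\<in>D k ` {a..b}. norm y \<le> M" by (auto simp: bounded_iff)
    then show ?thesis by (intro exI[of _ "max 0 M"]) (auto simp: max_def)
  qed
  then obtain M where M: "\<And>k. M k \<ge> 0" "\<And>k x. x \<in> {a..b} \<Longrightarrow> \<bar>D k x\<bar> \<le> M k" by metis
  have "\<exists>C\<ge>0. \<forall>t. t \<noteq> 0 \<longrightarrow> \<bar>log_power s \<mu> k t\<bar> \<le> C * \<bar>t\<bar> powr (s - real k) * (1 + \<bar>ln \<bar>t\<bar>\<bar>) ^ \<mu>" for k
    by (rule abs_log_power_le[of s \<mu> k]) blast
  then obtain N where N: "\<And>k. N k \<ge> 0"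
    "\<And>k t. t \<noteq> 0 \<Longrightarrow> \<bar>log_power s \<mu> k t\<bar> \<le> N k * \<bar>t\<bar> powr (s - real k) * (1 + \<bar>ln \<bar>t\<bar>\<bar>) ^ \<mu>"
    by metis
  define F where "F k x = (\<Sum>j\<le>k. real (k choose j) * log_power s \<mu> j (x - z) * D (k - j) x)" for k x
  \<comment> \<open>The power of \<open>b - a\<close> absorbs the milder singularities:
    \<open>\<bar>x - z\<bar> powr (s - j)\<close> is \<open>\<bar>x - z\<bar> powr (s - k)\<close>
    times \<open>\<bar>x - z\<bar> ^ (k - j)\<close>, and
    \<open>\<bar>x - z\<bar> \<le> b - a\<close>.\<close>
  define C where "C k = (\<Sum>j\<le>k. real (k choose j) * (N j * (b - a) ^ (k - j)) * M (k - j))" for k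
  show thesis
  proof (rule that[of F C])
    show "F 0 x = \<bar>x - z\<bar> powr s * ln \<bar>x - z\<bar> ^ \<mu> * g x" if "x \<in> {a..b}" for x
      using that by (simp add: F_def D0 log_power_def poly_monom)
    show "(F k has_real_derivative F (Suc k) x) (at x within {a..b})" if "x \<in> {a..b}" "x \<noteq> z" for k x
      unfolding F_def using that
      by (intro Leibniz_has_real_derivative has_real_derivative_log_power D)
    show "C k \<ge> 0" for k
      unfolding C_def using N M z by (intro sum_nonneg mult_nonneg_nonneg) auto
    show "\<bar>F k x\<bar> \<le> C k * \<bar>x - z\<bar> powr (s - real k) * (1 + \<bar>ln \<bar>x - z\<bar>\<bar>) ^ \<mu>"
      if x: "x \<in> {a..b}" "x \<noteq> z" for k x
    proof -
      define t where "t = \<bar>x - z\<bar>"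
      have t: "t > 0" "t \<le> b - a" using x z by (auto simp: t_def)
      define L where "L = (1 + \<bar>ln t\<bar>) ^ \<mu>"
      have L: "L \<ge> 0" by (simp add: L_def)
      have "\<bar>F k x\<bar> \<le> (\<Sum>j\<le>k. real (k choose j) * \<bar>log_power s \<mu> j (x - z)\<bar> * \<bar>D (k - j) x\<bar>)"
        unfolding F_def by (rule order.trans[OF sum_abs]) (simp add: abs_mult)
      also have "\<dots> \<le> (\<Sum>j\<le>k. real (k choose j) * (N j * (b - a) ^ (k - j) * t powr (s - real k) * L) * M (k - j))"
      proof (intro sum_mono mult_mono mult_left_mono mult_nonneg_nonneg)
        fix j assume j: "j \<in> {..k}"
        have "s - real j = (s - real k) + real (k - j)" using j by (simp add: of_nat_diff)
        then have "t powr (s - real j) = t powr (s - real k) * t ^ (k - j)"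
          using t(1) by (simp only: powr_add powr_realpow)
        also have "\<dots> \<le> t powr (s - real k) * (b - a) ^ (k - j)"
          using t by (intro mult_left_mono power_mono) auto
        finally have "N j * t powr (s - real j) * L \<le> N j * (t powr (s - real k) * (b - a) ^ (k - j)) * L"
          using N(1) L by (intro mult_right_mono mult_left_mono) auto
        then show "\<bar>log_power s \<mu> j (x - z)\<bar> \<le> N j * (b - a) ^ (k - j) * t powr (s - real k) * L"
          using N(2)[of "x - z" j] x by (simp add: t_def L_def mult_ac)
      qed (use N M x z L in auto)
      also have "\<dots> = C k * t powr (s - real k) * L"
        unfolding C_def sum_distrib_right by (intro sum.cong refl) (simp only: mult_ac)
      finally show ?thesis by (simp add: t_def L_def)
    qed
  qed
qed

text \<open>With \<open>t = exp (- (ln T + L))\<close> and \<open>L \<ge> 0\<close>, the logarithm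
  is at most \<open>ln T * (1 + L)\<close> because \<open>ln T \<ge> 1\<close>, while
  \<open>t powr s\<close> contributes \<open>exp (- (s * L))\<close>, which absorbs
  \<open>(1 + L) ^ \<mu>\<close> uniformly in \<open>L\<close>.\<close>

lemma powr_ln_power_le:
  fixes s t T :: real
  assumes "s > 0" "0 < t" "t \<le> 1 / T" "exp 1 \<le> T"
  shows "t powr s * \<bar>ln t\<bar> ^ \<mu> \<le> max 1 (real \<mu> / s) ^ \<mu> * (T powr (- s) * ln T ^ \<mu>)"
proof -
  have T: "T > 0" "ln T \<ge> 1"
    using assms(4) exp_gt_zero[of "1::real"] by (linarith, subst ln_ge_iff, linarith+)
  define L where "L = ln (1 / (T * t))"
  have "T * t > 0" "T * t \<le> 1" using assms T by (auto simp: field_simps)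
  then have L: "L \<ge> 0" by (simp add: L_def)
  have ln_t: "ln t = - (ln T + L)" using assms T by (simp add: L_def ln_div ln_mult)
  \<comment> \<open>For \<open>\<mu> > 0\<close> this choice gives \<open>1 + L \<le> c * (1 + s * L
    / \<mu>) \<le> c * exp (s * L / \<mu>)\<close>, whose \<open>\<mu>\<close>-th power is the
    wanted bound.\<close>
  define c where "c = max 1 (real \<mu> / s)"
  have c: "c \<ge> 1" by (simp add: c_def)
  have "(1 + L) ^ \<mu> \<le> c ^ \<mu> * exp (s * L)"
  proof (cases "\<mu> = 0")
    case True
    then show ?thesis using L assms(1) by simp
  next
    case False
    have "1 \<le> c * s / real \<mu>"
      using False assms(1) mult_right_mono[OF max.cobounded2[of "real \<mu> / s" 1], of "s / real \<mu>"]
      by (simp add: c_def)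
    from mult_right_mono[OF this L] have "1 + L \<le> c * (1 + s * L / real \<mu>)"
      using c by (simp add: algebra_simps)
    also have "\<dots> \<le> c * exp (s * L / real \<mu>)"
      using c by (intro mult_left_mono exp_ge_add_one_self) auto
    finally have "(1 + L) ^ \<mu> \<le> (c * exp (s * L / real \<mu>)) ^ \<mu>"
      using L by (intro power_mono) auto
    also have "\<dots> = c ^ \<mu> * exp (s * L)"
      using False by (simp add: power_mult_distrib flip: exp_of_nat_mult)
    finally show ?thesis .
  qed
  then have "exp (- (s * L)) * (1 + L) ^ \<mu> \<le> c ^ \<mu>"
    by (simp add: exp_minus field_simps)
  moreover have "\<bar>ln t\<bar> ^ \<mu> \<le> (ln T * (1 + L)) ^ \<mu>"
    using T L mult_right_mono[of 1 "ln T" L] by (intro power_mono) (auto simp: ln_t algebra_simps)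
  moreover have "t powr s = T powr (- s) * exp (- (s * L))"
    using assms T by (simp add: powr_def ln_t exp_add[symmetric] algebra_simps)
  ultimately have "t powr s * \<bar>ln t\<bar> ^ \<mu> \<le> T powr (- s) * exp (- (s * L)) * (ln T * (1 + L)) ^ \<mu>"
    by (simp add: mult_left_mono)
  also have "\<dots> = T powr (- s) * ln T ^ \<mu> * (exp (- (s * L)) * (1 + L) ^ \<mu>)"
    by (simp add: power_mult_distrib)
  finally have le: "t powr s * \<bar>ln t\<bar> ^ \<mu> \<le> T powr (- s) * ln T ^ \<mu> * (exp (- (s * L)) * (1 + L) ^ \<mu>)" .
  have "ln T ^ \<mu> \<ge> 0" by (rule zero_le_power) (use T in linarith)
  then have "T powr (- s) * ln T ^ \<mu> * (exp (- (s * L)) * (1 + L) ^ \<mu>) \<le> T powr (- s) * ln T ^ \<mu> * c ^ \<mu>"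
    using T \<open>exp (- (s * L)) * (1 + L) ^ \<mu> \<le> c ^ \<mu>\<close>
    by (intro mult_left_mono mult_nonneg_nonneg) auto
  with le show ?thesis by (simp add: c_def mult_ac)
qed

section \<open>Repeated integration by parts\<close>

lemma jacobi_sigma_pos:
  assumes "\<alpha> > -1" "\<beta> > -1" "n > 0"
  shows "0 < jacobi_sigma \<alpha> \<beta> n"
proof (cases n)
  case (Suc m)
  then show ?thesis
    unfolding Suc jacobi_sigma_Suc_Gamma[OF assms(1,2)] using assms
    by (intro mult_pos_pos divide_pos_pos Gamma_real_pos) auto
qed (use assms in simp)

text \<open>
  Up to a constant, the \<open>j\<close>-th derivative of \<open>jacobi_raised \<alpha> \<beta> (k + j) n\<close> is
  \<open>jacobi_raised \<alpha> \<beta> k n\<close>: this is Rodrigues' formula for \<open>k = 0\<close>, \<open>j = n\<close>.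
\<close>
definition jacobi_raised :: "real \<Rightarrow> real \<Rightarrow> nat \<Rightarrow> nat \<Rightarrow> real \<Rightarrow> real" where
  "jacobi_raised \<alpha> \<beta> k n x =
     jacobi_weight (\<alpha> + real k) (\<beta> + real k) x * jacobi_P (\<alpha> + real k) (\<beta> + real k) (n - k) x"

lemma has_real_derivative_jacobi_raised:
  assumes "k < n" "-1 < x" "x < 1"
  shows "(jacobi_raised \<alpha> \<beta> (Suc k) n has_real_derivative
            - 2 * real (n - k) * jacobi_raised \<alpha> \<beta> k n x) (at x)"
proof -
  have "Suc (n - Suc k) = n - k" using assms by simp
  moreover have "\<alpha> + real (Suc k) = \<alpha> + real k + 1" "\<beta> + real (Suc k) = \<beta> + real k + 1" by simp_all
  moreover have "real (n - Suc k) + 1 = real (n - k)" using assms by (simp add: of_nat_diff)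
  ultimately show ?thesis
    unfolding jacobi_raised_def[abs_def]
    using has_real_derivative_jacobi_weight_P[OF assms(2,3), of "\<alpha> + real k" "\<beta> + real k" "n - Suc k"]
    by metis
qed

lemma continuous_on_jacobi_raised:
  assumes "\<alpha> > -1" "\<beta> > -1" "k > 0"
  shows "continuous_on {-1..1} (jacobi_raised \<alpha> \<beta> k n)"
proof -
  have "1 \<le> real k" using assms(3) by simp
  then show ?thesis
    unfolding jacobi_raised_def[abs_def] using assms
    by (intro continuous_intros continuous_on_jacobi_weight) auto
qed

lemma jacobi_raised_endpoints [simp]:
  "jacobi_raised \<alpha> \<beta> k n 1 = 0" "jacobi_raised \<alpha> \<beta> k n (-1) = 0"
  by (simp_all add: jacobi_raised_def jacobi_weight_def)

text \<open>The interior bound for the raised parameters is in terms of the raised norm;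
  \<open>jacobi_sigma_raise_le\<close> returns to the norm of the original family, since degree
  \<open>n - k\<close> with parameters raised \<open>k\<close> times corresponds to degree
  \<open>n\<close>.\<close>

lemma jacobi_raised_interior_bound:
  assumes ab: "\<alpha> > -1" "\<beta> > -1" and cd: "-1 < c" "c < d" "d < 1"
  obtains Q where "Q \<ge> 0"
    "\<And>n x. k < n \<Longrightarrow> x \<in> {c..d} \<Longrightarrow> \<bar>jacobi_raised \<alpha> \<beta> k n x\<bar> \<le> Q * sqrt (jacobi_sigma \<alpha> \<beta> n)"
proof -
  have ab': "\<alpha> + real k > -1" "\<beta> + real k > -1" using ab by auto
  obtain C1 where C1: "C1 > 0" "\<And>n x. x \<in> {c..d} \<Longrightarrow>
      (jacobi_P (\<alpha> + real k) (\<beta> + real k) (Suc n) x)\<^sup>2 \<le> C1 * jacobi_sigma (\<alpha> + real k) (\<beta> + real k) (Suc n)"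
    using jacobi_P_interior_bound[OF ab' cd] by blast
  obtain C2 where C2: "C2 > 0"
      "\<And>n. jacobi_sigma (\<alpha> + real k) (\<beta> + real k) n \<le> C2 * jacobi_sigma \<alpha> \<beta> (n + k)"
    using jacobi_sigma_raise_le[OF ab] by blast
  have "continuous_on {c..d} (jacobi_weight (\<alpha> + real k) (\<beta> + real k))"
    unfolding jacobi_weight_def[abs_def] using cd
    by (intro continuous_on_mult continuous_on_powr continuous_intros) auto
  then have "bounded (jacobi_weight (\<alpha> + real k) (\<beta> + real k) ` {c..d})"
    by (intro compact_imp_bounded compact_continuous_image) auto
  then obtain W where "\<forall>x\<in>{c..d}. jacobi_weight (\<alpha> + real k) (\<beta> + real k) x \<le> W"
    by (auto simp: bounded_iff)
  then have W: "\<And>x. x \<in> {c..d} \<Longrightarrow> jacobi_weight (\<alpha> + real k) (\<beta> + real k) x \<le> W"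
    by blast
  have W0: "W \<ge> 0" using order.trans[OF jacobi_weight_nonneg W[of c]] cd by simp
  show thesis
  proof (rule that[of "W * sqrt (C1 * C2)"])
    show "W * sqrt (C1 * C2) \<ge> 0" using W0 C1 C2 by simp
    fix n x assume n: "k < n" and x: "x \<in> {c..d}"
    \<comment> \<open>The interior bound concerns positive degrees only, and \<open>k < n\<close>
      makes \<open>n - k\<close> one.\<close>
    have "Suc (n - Suc k) = n - k" using n by simp
    then have "(jacobi_P (\<alpha> + real k) (\<beta> + real k) (n - k) x)\<^sup>2
        \<le> C1 * jacobi_sigma (\<alpha> + real k) (\<beta> + real k) (n - k)"
      using C1(2)[OF x, of "n - Suc k"] by metis
    also have "\<dots> \<le> C1 * (C2 * jacobi_sigma \<alpha> \<beta> n)"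
      using C1(1) C2(2)[of "n - k"] n by (intro mult_left_mono) auto
    finally have "\<bar>jacobi_P (\<alpha> + real k) (\<beta> + real k) (n - k) x\<bar> \<le> sqrt (C1 * C2 * jacobi_sigma \<alpha> \<beta> n)"
      by (intro real_le_rsqrt) (simp add: mult.assoc)
    then show "\<bar>jacobi_raised \<alpha> \<beta> k n x\<bar> \<le> W * sqrt (C1 * C2) * sqrt (jacobi_sigma \<alpha> \<beta> n)"
      unfolding jacobi_raised_def abs_mult real_sqrt_mult mult.assoc
      using W[OF x] W0 C1 C2 by (intro mult_mono) (auto simp: real_sqrt_mult)
  qed
qed

text \<open>A form of the Cauchy-Schwarz estimate obtained pointwise:
  \<open>\<bar>P\<bar> \<le> r + P\<^sup>2 / r\<close> for \<open>r > 0\<close>, integrated against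
  the raised weight.\<close>

lemma integral_abs_jacobi_raised_le:
  assumes ab: "\<alpha> > -1" "\<beta> > -1" and "k > 0"
  obtains Q where "Q \<ge> 0"
    "\<And>n. k < n \<Longrightarrow> integral {-1..1} (\<lambda>x. \<bar>jacobi_raised \<alpha> \<beta> k n x\<bar>) \<le> Q * sqrt (jacobi_sigma \<alpha> \<beta> n)"
proof -
  have ab': "\<alpha> + real k > -1" "\<beta> + real k > -1" using ab by auto
  let ?w = "jacobi_weight (\<alpha> + real k) (\<beta> + real k)"
  obtain C where C: "C > 0"
      "\<And>n. jacobi_sigma (\<alpha> + real k) (\<beta> + real k) n \<le> C * jacobi_sigma \<alpha> \<beta> (n + k)"
    using jacobi_sigma_raise_le[OF ab] by blast
  have w_int: "?w integrable_on {-1..1}"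
    using has_integral_jacobi_weight[OF ab'] by (auto simp: has_integral_iff)
  define W where "W = integral {-1..1} ?w"
  have W: "W \<ge> 0" unfolding W_def by (intro integral_nonneg w_int) auto
  show thesis
  proof (rule that[of "W + C"])
    show "W + C \<ge> 0" using W C by simp
    fix n assume n: "k < n"
    \<comment> \<open>With this \<open>r\<close> the two parts of the majorant balance: their
      integrals are \<open>r * W\<close> and at most \<open>C * r\<^sup>2 / r\<close>.\<close>
    define r where "r = sqrt (jacobi_sigma \<alpha> \<beta> n)"
    have r: "r > 0" "r\<^sup>2 = jacobi_sigma \<alpha> \<beta> n"
      using jacobi_sigma_pos[OF ab, of n] n by (auto simp: r_def)
    let ?P = "jacobi_P (\<alpha> + real k) (\<beta> + real k) (n - k)"
    have maj: "((\<lambda>x. r * ?w x + (1 / r) * (?w x * (?P x)\<^sup>2)) has_integral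
        r * W + (1 / r) * jacobi_sigma (\<alpha> + real k) (\<beta> + real k) (n - k)) {-1..1}"
      unfolding W_def
      by (intro has_integral_add has_integral_mult_right has_integral_jacobi_sigma ab' integrable_integral w_int)
    have "integral {-1..1} (\<lambda>x. \<bar>jacobi_raised \<alpha> \<beta> k n x\<bar>)
        \<le> integral {-1..1} (\<lambda>x. r * ?w x + (1 / r) * (?w x * (?P x)\<^sup>2))"
    proof (rule integral_le)
      show "(\<lambda>x. \<bar>jacobi_raised \<alpha> \<beta> k n x\<bar>) integrable_on {-1..1}"
        using assms by (intro integrable_continuous_interval continuous_intros continuous_on_jacobi_raised)
      show "(\<lambda>x. r * ?w x + (1 / r) * (?w x * (?P x)\<^sup>2)) integrable_on {-1..1}"
        using maj by (auto simp: has_integral_iff)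
      fix x :: real assume "x \<in> {-1..1}"
      have "r * \<bar>?P x\<bar> \<le> r\<^sup>2 + (?P x)\<^sup>2"
        using sum_squares_bound[of r "\<bar>?P x\<bar>"] r(1) mult_nonneg_nonneg[of r "\<bar>?P x\<bar>"]
        by (simp del: mult_nonneg_nonneg)
      then have "\<bar>?P x\<bar> \<le> r + (1 / r) * (?P x)\<^sup>2"
        using r(1) by (simp add: field_simps power2_eq_square)
      from mult_left_mono[OF this jacobi_weight_nonneg]
      show "\<bar>jacobi_raised \<alpha> \<beta> k n x\<bar> \<le> r * ?w x + (1 / r) * (?w x * (?P x)\<^sup>2)"
        by (simp add: jacobi_raised_def abs_mult algebra_simps)
    qed
    also have "\<dots> = r * W + (1 / r) * jacobi_sigma (\<alpha> + real k) (\<beta> + real k) (n - k)"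
      using maj by (rule integral_unique)
    also have "\<dots> \<le> r * W + (1 / r) * (C * r\<^sup>2)"
      using r C(2)[of "n - k"] n by (intro add_left_mono mult_left_mono) auto
    also have "\<dots> = (W + C) * r"
      using r(1) by (simp add: field_simps power2_eq_square)
    finally show "integral {-1..1} (\<lambda>x. \<bar>jacobi_raised \<alpha> \<beta> k n x\<bar>) \<le> (W + C) * sqrt (jacobi_sigma \<alpha> \<beta> n)"
      by (simp add: r_def)
  qed
qed

text \<open>The interval may reach an endpoint, where the integrand on the left can be unbounded for
  \<open>k = 0\<close>. The raised function is continuous on the closed interval, so the fundamental
  theorem needs the derivative in the interior only.\<close>

lemma jacobi_raised_by_parts:
  fixes h h' :: "real \<Rightarrow> real"
  assumes ab: "\<alpha> > -1" "\<beta> > -1" and k: "k < n" and cd: "-1 \<le> c" "c \<le> d" "d \<le> 1"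
    and h: "continuous_on {c..d} h" and h': "continuous_on {c..d} h'"
    and deriv: "\<And>x. x \<in> {c<..<d} \<Longrightarrow> (h has_real_derivative h' x) (at x)"
  shows "2 * real (n - k) * integral {c..d} (\<lambda>x. h x * jacobi_raised \<alpha> \<beta> k n x)
    = integral {c..d} (\<lambda>x. h' x * jacobi_raised \<alpha> \<beta> (Suc k) n x)
      - (h d * jacobi_raised \<alpha> \<beta> (Suc k) n d - h c * jacobi_raised \<alpha> \<beta> (Suc k) n c)"
proof -
  let ?q = "jacobi_raised \<alpha> \<beta> k n" and ?Q = "jacobi_raised \<alpha> \<beta> (Suc k) n"
  have sub: "{c..d} \<subseteq> {-1..1}" using cd by auto
  have contQ: "continuous_on {c..d} ?Q"
    using continuous_on_jacobi_raised[OF ab zero_less_Suc] sub by (rule continuous_on_subset)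
  have "((\<lambda>x. h' x * ?Q x + h x * (- 2 * real (n - k) * ?q x)) has_integral h d * ?Q d - h c * ?Q c) {c..d}"
  proof (rule fundamental_theorem_of_calculus_interior[OF \<open>c \<le> d\<close>])
    show "continuous_on {c..d} (\<lambda>x. h x * ?Q x)" by (intro continuous_intros h contQ)
    fix x assume x: "x \<in> {c<..<d}"
    have "(?Q has_real_derivative - 2 * real (n - k) * ?q x) (at x)"
      using x cd by (intro has_real_derivative_jacobi_raised k) auto
    from DERIV_mult[OF deriv[OF x] this]
    show "((\<lambda>x. h x * ?Q x) has_vector_derivative h' x * ?Q x + h x * (- 2 * real (n - k) * ?q x)) (at x)"
      unfolding has_real_derivative_iff_has_vector_derivative[symmetric]
      by (rule DERIV_cong) simp
  qed
  moreover have "((\<lambda>x. h' x * ?Q x) has_integral integral {c..d} (\<lambda>x. h' x * ?Q x)) {c..d}"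
    by (intro integrable_integral integrable_continuous_interval continuous_intros h' contQ)
  \<comment> \<open>Subtracting the integrable continuous part gives the integrability of
    \<open>h * ?q\<close> together with its value.\<close>
  ultimately have "((\<lambda>x. h' x * ?Q x - (h' x * ?Q x + h x * (- 2 * real (n - k) * ?q x)))
      has_integral integral {c..d} (\<lambda>x. h' x * ?Q x) - (h d * ?Q d - h c * ?Q c)) {c..d}"
    by (intro has_integral_diff)
  then have "((\<lambda>x. 2 * real (n - k) * (h x * ?q x))
      has_integral integral {c..d} (\<lambda>x. h' x * ?Q x) - (h d * ?Q d - h c * ?Q c)) {c..d}"
    by (simp add: algebra_simps)
  from integral_unique[OF this] show ?thesis by simp
qed

text \<open>The antiderivative \<open>H\<close> is valid on either side of \<open>z\<close>, and
  \<open>z\<close> lies outside the interval. As \<open>p + 1 < 0\<close>,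
  \<open>\<bar>H\<bar>\<close> is largest at distance \<open>e\<close>; the two endpoints account
  for the factor \<open>2\<close>.\<close>

lemma integral_abs_powr_le:
  fixes z p e :: real
  assumes p: "p < -1" and e: "e > 0" and "c \<le> d" and far: "\<And>x. x \<in> {c..d} \<Longrightarrow> e \<le> \<bar>x - z\<bar>"
  shows "(\<lambda>x. \<bar>x - z\<bar> powr p) integrable_on {c..d}"
    and "integral {c..d} (\<lambda>x. \<bar>x - z\<bar> powr p) \<le> 2 / (- p - 1) * e powr (p + 1)"
proof -
  define H where "H x = (x - z) * \<bar>x - z\<bar> powr p / (p + 1)" for x
  have *: "((\<lambda>x. \<bar>x - z\<bar> powr p) has_integral H d - H c) {c..d}"
  proof (rule fundamental_theorem_of_calculus[OF \<open>c \<le> d\<close>])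
    fix x assume "x \<in> {c..d}"
    with far e have x: "x \<noteq> z" by fastforce
    have "((\<lambda>x. (x - z) * \<bar>x - z\<bar> powr p / (p + 1)) has_real_derivative
        (1 * \<bar>x - z\<bar> powr p + p * \<bar>x - z\<bar> powr p / (x - z) * (x - z)) / (p + 1)) (at x within {c..d})"
      by (intro DERIV_cdivide DERIV_mult has_real_derivative_abs_powr x) (auto intro!: derivative_eq_intros)
    moreover have "(1 * \<bar>x - z\<bar> powr p + p * \<bar>x - z\<bar> powr p / (x - z) * (x - z)) / (p + 1) = \<bar>x - z\<bar> powr p"
    proof -
      have "1 * \<bar>x - z\<bar> powr p + p * \<bar>x - z\<bar> powr p / (x - z) * (x - z) = (p + 1) * \<bar>x - z\<bar> powr p"
        using x by (simp add: distrib_right)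
      then show ?thesis using p by simp
    qed
    ultimately show "(H has_vector_derivative \<bar>x - z\<bar> powr p) (at x within {c..d})"
      unfolding H_def[abs_def] has_real_derivative_iff_has_vector_derivative[symmetric]
      by (rule DERIV_cong)
  qed
  then show "(\<lambda>x. \<bar>x - z\<bar> powr p) integrable_on {c..d}" by (auto simp: has_integral_iff)
  have H: "\<bar>H x\<bar> \<le> 1 / (- p - 1) * e powr (p + 1)" if "x \<in> {c..d}" for x
  proof -
    have pos: "\<bar>x - z\<bar> > 0" using far[OF that] e by simp
    have "\<bar>H x\<bar> = \<bar>x - z\<bar> powr (p + 1) / (- p - 1)"
      using p pos by (simp add: H_def abs_mult powr_add)
    also have "\<dots> \<le> e powr (p + 1) / (- p - 1)"
      using p e far[OF that] by (intro divide_right_mono powr_mono2') auto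
    finally show ?thesis by simp
  qed
  have "integral {c..d} (\<lambda>x. \<bar>x - z\<bar> powr p) = H d - H c" using * by (rule integral_unique)
  also have "\<dots> \<le> \<bar>H d\<bar> + \<bar>H c\<bar>" by simp
  also have "\<dots> \<le> 2 / (- p - 1) * e powr (p + 1)"
    using H[of c] H[of d] \<open>c \<le> d\<close> by simp
  finally show "integral {c..d} (\<lambda>x. \<bar>x - z\<bar> powr p) \<le> 2 / (- p - 1) * e powr (p + 1)" .
qed

text \<open>Downward induction from \<open>K\<close> to \<open>k\<close>. At \<open>K\<close> the
  exponent \<open>s - K < -1\<close> makes the direct estimate sharp enough; each integration by
  parts then lowers the power of \<open>n\<close> by one. The conditions on \<open>c\<close> and
  \<open>d\<close> cover both sides of \<open>z\<close> at once: boundary terms arise only at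
  \<open>\<plusminus>1\<close>, where they vanish, or at distance \<open>1 / n\<close> from
  \<open>z\<close>.\<close>

lemma outer_integral_bound:
  fixes F :: "nat \<Rightarrow> real \<Rightarrow> real" and C :: "nat \<Rightarrow> real" and s :: real and \<mu> N K :: nat
  assumes ab: "\<alpha> > -1" "\<beta> > -1" and z: "-1 < z - \<delta>" "z + \<delta> < 1" "\<delta> > 0"
    and deriv: "\<And>k x. x \<in> {-1..1} \<Longrightarrow> x \<noteq> z \<Longrightarrow>
          (F k has_real_derivative F (Suc k) x) (at x within {-1..1})"
    and C: "\<And>k. C k \<ge> 0"
    and F: "\<And>k x. x \<in> {-1..1} \<Longrightarrow> x \<noteq> z \<Longrightarrow>
          \<bar>F k x\<bar> \<le> C k * \<bar>x - z\<bar> powr (s - real k) * (1 + \<bar>ln \<bar>x - z\<bar>\<bar>) ^ \<mu>"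
    and K: "K > 0" "s + 1 < real K"
    and N: "3 \<le> N" "2 * K + 2 \<le> N" "1 / \<delta> \<le> real N"
    and "k \<le> K"
  shows "\<exists>B\<ge>0. \<forall>n\<ge>N. \<forall>c d. -1 \<le> c \<and> c \<le> d \<and> d \<le> 1 \<and> (c = -1 \<or> c = z + 1 / real n)
      \<and> (d = 1 \<or> d = z - 1 / real n) \<and> (\<forall>x\<in>{c..d}. 1 / real n \<le> \<bar>x - z\<bar>) \<longrightarrow>
      \<bar>integral {c..d} (\<lambda>x. F k x * jacobi_raised \<alpha> \<beta> k n x)\<bar>
        \<le> B * (ln (real n) ^ \<mu> * real n powr (real k - s - 1) * sqrt (jacobi_sigma \<alpha> \<beta> n))"
proof -
  define r where "r n = sqrt (jacobi_sigma \<alpha> \<beta> n)" for n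
  have r: "r n \<ge> 0" for n by (simp add: r_def jacobi_sigma_nonneg)
  define adm where "adm n c d \<longleftrightarrow> -1 \<le> c \<and> c \<le> d \<and> d \<le> 1 \<and> (c = -1 \<or> c = z + 1 / real n)
      \<and> (d = 1 \<or> d = z - 1 / real n) \<and> (\<forall>x\<in>{c..d}. 1 / real n \<le> \<bar>x - z\<bar>)" for n c d
  \<comment> \<open>\<open>3 \<le> N\<close> ensures \<open>exp 1 \<le> n\<close>, and
    \<open>1 / \<delta> \<le> N\<close> keeps \<open>z \<plusminus> 1 / n\<close> where the interior
    bound applies. \<open>2 * K + 2 \<le> N\<close> gives \<open>K < n\<close> and, in the induction
    step, \<open>n \<le> 2 * (n - k)\<close>.\<close>
  have n_props: "real n > 0" "1 \<le> ln (real n)" "1 / real n \<le> \<delta>" "K < n" if "n \<ge> N" for n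
  proof -
    show "real n > 0" "K < n" using that N by auto
    have "exp 1 \<le> real n" using that N exp_le by simp
    then show "1 \<le> ln (real n)" using \<open>real n > 0\<close> by (simp add: ln_ge_iff)
    have "1 / \<delta> \<le> real n" using that N by linarith
    then show "1 / real n \<le> \<delta>" using \<open>real n > 0\<close> z by (simp add: field_simps)
  qed
  \<comment> \<open>From \<open>1 / n \<le> \<bar>x - z\<bar> \<le> 2 \<le> n\<close> the logarithm
    is at most \<open>ln n\<close> in absolute value, and the summand \<open>1\<close> is also at
    most \<open>ln n\<close>.\<close>
  have F_far: "\<bar>F j x\<bar> \<le> C j * \<bar>x - z\<bar> powr (s - real j) * (2 * ln (real n)) ^ \<mu>"
    if n: "n \<ge> N" and x: "x \<in> {-1..1}" "1 / real n \<le> \<bar>x - z\<bar>" for n j x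
  proof -
    have xz: "\<bar>x - z\<bar> > 0" using x n_props(1)[OF n] by (smt (verit) divide_pos_pos)
    have "\<bar>x - z\<bar> \<le> 2" using x z by auto
    also have "2 \<le> real n" using n N by simp
    finally have "ln \<bar>x - z\<bar> \<le> ln (real n)" using xz by (subst ln_le_cancel_iff) auto
    moreover have "ln (1 / real n) \<le> ln \<bar>x - z\<bar>"
      using x xz n_props(1)[OF n] by (subst ln_le_cancel_iff) auto
    ultimately have "1 + \<bar>ln \<bar>x - z\<bar>\<bar> \<le> 2 * ln (real n)"
      using n_props(1,2)[OF n] by (simp add: ln_div)
    then have "(1 + \<bar>ln \<bar>x - z\<bar>\<bar>) ^ \<mu> \<le> (2 * ln (real n)) ^ \<mu>" by (intro power_mono) auto
    then have "C j * \<bar>x - z\<bar> powr (s - real j) * (1 + \<bar>ln \<bar>x - z\<bar>\<bar>) ^ \<mu>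
        \<le> C j * \<bar>x - z\<bar> powr (s - real j) * (2 * ln (real n)) ^ \<mu>"
      using C by (intro mult_left_mono) auto
    with F[of x j] x xz show ?thesis by fastforce
  qed
  have cont: "continuous_on {c..d} (F j)" if "n \<ge> N" "adm n c d" for n c d j
  proof -
    have "x \<in> {-1..1}" "x \<noteq> z" if "x \<in> {c..d}" for x
    proof -
      have "1 / real n \<le> \<bar>x - z\<bar>" using \<open>adm n c d\<close> that by (auto simp: adm_def)
      then show "x \<noteq> z" using n_props(1)[OF \<open>n \<ge> N\<close>] by auto
      show "x \<in> {-1..1}" using \<open>adm n c d\<close> that by (auto simp: adm_def)
    qed
    then have "(F j has_real_derivative F (Suc j) x) (at x within {c..d})" if "x \<in> {c..d}" for x
      using that by (intro DERIV_subset[OF deriv]) auto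
    then show ?thesis by (rule DERIV_continuous_on)
  qed
  have "\<exists>B\<ge>0. \<forall>n\<ge>N. \<forall>c d. adm n c d \<longrightarrow>
      \<bar>integral {c..d} (\<lambda>x. F k x * jacobi_raised \<alpha> \<beta> k n x)\<bar>
        \<le> B * (ln (real n) ^ \<mu> * real n powr (real k - s - 1) * r n)"
    using \<open>k \<le> K\<close>
  proof (induction rule: inc_induct)
    case base
    obtain Q where Q: "Q \<ge> 0" "\<And>n x. K < n \<Longrightarrow> x \<in> {z - \<delta>..z + \<delta>} \<Longrightarrow>
        \<bar>jacobi_raised \<alpha> \<beta> K n x\<bar> \<le> Q * r n"
      unfolding r_def using jacobi_raised_interior_bound[OF ab, of "z - \<delta>" "z + \<delta>" K] z by auto
    obtain Q' where Q': "Q' \<ge> 0" "\<And>n. K < n \<Longrightarrow>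
        integral {-1..1} (\<lambda>x. \<bar>jacobi_raised \<alpha> \<beta> K n x\<bar>) \<le> Q' * r n"
      unfolding r_def using integral_abs_jacobi_raised_le[OF ab K(1)] by blast
    define p where "p = s - real K"
    have p: "p < -1" using K by (simp add: p_def)
    \<comment> \<open>The first summand comes from \<open>\<bar>x - z\<bar> \<le> \<delta>\<close>,
      with the pointwise bound and the integral of the power; the second from the rest, where the
      power is at most \<open>\<delta> powr p\<close> and the integral bound on the raised function
      is used.\<close>
    define A where "A = Q * (2 / (- p - 1)) + \<delta> powr p * Q'"
    have A: "A \<ge> 0" using Q Q' p by (simp add: A_def)
    show ?case
    proof (rule exI[of _ "C K * 2 ^ \<mu> * A"], intro conjI allI impI)
      show "0 \<le> C K * 2 ^ \<mu> * A" using A C by simp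
      fix n c d assume n: "n \<ge> N" and adm: "adm n c d"
      let ?q = "jacobi_raised \<alpha> \<beta> K n"
      define l where "l = C K * (2 * ln (real n)) ^ \<mu>"
      have l: "l \<ge> 0" unfolding l_def using C n_props(2)[OF n] by simp
      have sub: "{c..d} \<subseteq> {-1..1}" and "c \<le> d"
        and far: "\<And>x. x \<in> {c..d} \<Longrightarrow> 1 / real n \<le> \<bar>x - z\<bar>"
        using adm by (auto simp: adm_def)
      have q_cont: "continuous_on {-1..1} ?q"
        by (rule continuous_on_jacobi_raised[OF ab K(1)])
      have q_cont': "continuous_on {c..d} ?q" using q_cont sub by (rule continuous_on_subset)
      have e: "1 / real n > 0" using n_props(1)[OF n] by simp
      note powr_int = integral_abs_powr_le[OF p e \<open>c \<le> d\<close> far]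
      have abs_q_int: "(\<lambda>x. \<bar>?q x\<bar>) integrable_on {c..d}"
        by (intro integrable_continuous_interval continuous_intros q_cont')
      have maj_int: "(\<lambda>x. l * (Q * r n * \<bar>x - z\<bar> powr p + \<delta> powr p * \<bar>?q x\<bar>)) integrable_on {c..d}"
        by (intro integrable_on_mult_right integrable_add powr_int(1) abs_q_int)
      have "norm (integral {c..d} (\<lambda>x. F K x * ?q x))
          \<le> integral {c..d} (\<lambda>x. l * (Q * r n * \<bar>x - z\<bar> powr p + \<delta> powr p * \<bar>?q x\<bar>))"
      proof (rule integral_norm_bound_integral[OF _ maj_int])
        show "(\<lambda>x. F K x * ?q x) integrable_on {c..d}"
          by (intro integrable_continuous_interval continuous_intros q_cont' cont[OF n adm])
        fix x assume x: "x \<in> {c..d}"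
        have "\<bar>F K x\<bar> \<le> l * \<bar>x - z\<bar> powr p"
          using F_far[OF n, of x K] far[OF x] x sub by (auto simp: l_def p_def mult_ac)
        then have "\<bar>F K x * ?q x\<bar> \<le> l * \<bar>x - z\<bar> powr p * \<bar>?q x\<bar>"
          unfolding abs_mult by (intro mult_right_mono) auto
        also have "\<dots> = l * (\<bar>x - z\<bar> powr p * \<bar>?q x\<bar>)" by simp
        also have "\<dots> \<le> l * (Q * r n * \<bar>x - z\<bar> powr p + \<delta> powr p * \<bar>?q x\<bar>)"
        proof (intro mult_left_mono l)
          show "\<bar>x - z\<bar> powr p * \<bar>?q x\<bar> \<le> Q * r n * \<bar>x - z\<bar> powr p + \<delta> powr p * \<bar>?q x\<bar>"
          proof (cases "\<bar>x - z\<bar> \<le> \<delta>")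
            case True
            then have "x \<in> {z - \<delta>..z + \<delta>}" by auto
            then have "\<bar>x - z\<bar> powr p * \<bar>?q x\<bar> \<le> \<bar>x - z\<bar> powr p * (Q * r n)"
              using Q(2)[OF n_props(4)[OF n]] by (intro mult_left_mono) auto
            moreover have "0 \<le> \<delta> powr p * \<bar>?q x\<bar>" by simp
            ultimately show ?thesis by (simp only: mult.commute[of "\<bar>x - z\<bar> powr p" "Q * r n"])
          next
            case False
            then have "\<bar>x - z\<bar> powr p * \<bar>?q x\<bar> \<le> \<delta> powr p * \<bar>?q x\<bar>"
              using p z by (intro mult_right_mono powr_mono2') auto
            moreover have "0 \<le> Q * r n * \<bar>x - z\<bar> powr p" using Q r by simp
            ultimately show ?thesis by linarith
          qed
        qed
        finally show "norm (F K x * ?q x) \<le> l * (Q * r n * \<bar>x - z\<bar> powr p + \<delta> powr p * \<bar>?q x\<bar>)"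
          by simp
      qed
      also have "\<dots> = l * (Q * r n * integral {c..d} (\<lambda>x. \<bar>x - z\<bar> powr p)
          + \<delta> powr p * integral {c..d} (\<lambda>x. \<bar>?q x\<bar>))"
        by (subst integral_mult_right, subst integral_add)
           (auto intro!: integrable_on_mult_right powr_int(1) abs_q_int)
      also have "\<dots> \<le> l * (Q * r n * (2 / (- p - 1) * (1 / real n) powr (p + 1)) + \<delta> powr p * (Q' * r n * real n powr (- p - 1)))"
      proof (intro mult_left_mono l add_mono mult_nonneg_nonneg Q r)
        show "integral {c..d} (\<lambda>x. \<bar>x - z\<bar> powr p) \<le> 2 / (- p - 1) * (1 / real n) powr (p + 1)"
          by (rule powr_int(2))
        have "integral {c..d} (\<lambda>x. \<bar>?q x\<bar>) \<le> integral {-1..1} (\<lambda>x. \<bar>?q x\<bar>)"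
          by (intro integral_subset_le sub abs_q_int integrable_continuous_interval continuous_intros q_cont) auto
        also have "\<dots> \<le> Q' * r n" by (rule Q'(2)[OF n_props(4)[OF n]])
        \<comment> \<open>Here \<open>- p - 1 > 0\<close>, so the part far from \<open>z\<close> may
          be enlarged to the order of the near part.\<close>
        also have "\<dots> \<le> Q' * r n * real n powr (- p - 1)"
        proof -
          have "1 \<le> real n powr (- p - 1)"
            using p n_props(1)[OF n] by (intro ge_one_powr_ge_zero) auto
          from mult_left_mono[OF this mult_nonneg_nonneg[OF Q'(1) r]] show ?thesis by simp
        qed
        finally show "integral {c..d} (\<lambda>x. \<bar>?q x\<bar>) \<le> Q' * r n * real n powr (- p - 1)" .
      qed simp
      also have "(1 / real n) powr (p + 1) = real n powr (- p - 1)"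
        using n_props(1)[OF n] by (simp add: powr_divide powr_minus_divide[symmetric])
      also have "l * (Q * r n * (2 / (- p - 1) * real n powr (- p - 1)) + \<delta> powr p * (Q' * r n * real n powr (- p - 1)))
          = C K * 2 ^ \<mu> * A * (ln (real n) ^ \<mu> * real n powr (real K - s - 1) * r n)"
        by (simp add: l_def A_def p_def power_mult_distrib algebra_simps)
      finally show "\<bar>integral {c..d} (\<lambda>x. F K x * ?q x)\<bar>
          \<le> C K * 2 ^ \<mu> * A * (ln (real n) ^ \<mu> * real n powr (real K - s - 1) * r n)" by simp
    qed
  next
    case (step k)
    obtain B where B: "B \<ge> 0" "\<And>n c d. n \<ge> N \<Longrightarrow> adm n c d \<Longrightarrow>
        \<bar>integral {c..d} (\<lambda>x. F (Suc k) x * jacobi_raised \<alpha> \<beta> (Suc k) n x)\<bar>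
          \<le> B * (ln (real n) ^ \<mu> * real n powr (real (Suc k) - s - 1) * r n)"
      using step.IH by blast
    obtain Q where Q: "Q \<ge> 0" "\<And>n x. Suc k < n \<Longrightarrow> x \<in> {z - \<delta>..z + \<delta>} \<Longrightarrow>
        \<bar>jacobi_raised \<alpha> \<beta> (Suc k) n x\<bar> \<le> Q * r n"
      unfolding r_def using jacobi_raised_interior_bound[OF ab, of "z - \<delta>" "z + \<delta>" "Suc k"] z by auto
    define A where "A = C k * 2 ^ \<mu> * Q"
    have A: "A \<ge> 0" using C Q by (simp add: A_def)
    show ?case
    proof (rule exI[of _ "B + 2 * A"], intro conjI allI impI)
      show "0 \<le> B + 2 * A" using A B by simp
      fix n c d assume n: "n \<ge> N" and adm: "adm n c d"
      let ?q = "jacobi_raised \<alpha> \<beta> k n" and ?Q = "jacobi_raised \<alpha> \<beta> (Suc k) n"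
      \<comment> \<open>\<open>Y\<close> has the order of both the boundary terms and the induction
        hypothesis, as \<open>Suc k - s - 1 = k - s\<close>; dividing by
        \<open>2 * (n - k) \<ge> n\<close> then produces \<open>k - s - 1\<close>.\<close>
      define Y where "Y = ln (real n) ^ \<mu> * real n powr (real k - s) * r n"
      have Y: "Y \<ge> 0" unfolding Y_def using r n_props(2)[OF n] by simp
      have k: "Suc k < n" "k < n" "real n \<le> 2 * real (n - k)"
        using step.hyps n N by (auto simp: of_nat_diff)
      have boundary: "\<bar>F k x * ?Q x\<bar> \<le> A * Y"
        if "x \<in> {-1..1}" and x: "x = -1 \<or> x = 1 \<or> x = z + 1 / real n \<or> x = z - 1 / real n" for x
      proof (cases "x = -1 \<or> x = 1")
        case True
        then have "?Q x = 0" by auto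
        then show ?thesis using A Y by simp
      next
        case False
        with x n_props(1)[OF n] have xz: "\<bar>x - z\<bar> = 1 / real n" by auto
        then have "\<bar>F k x\<bar> \<le> C k * (1 / real n) powr (s - real k) * (2 * ln (real n)) ^ \<mu>"
          using F_far[OF n, of x k] \<open>x \<in> {-1..1}\<close> by simp
        also have "(1 / real n) powr (s - real k) = real n powr (real k - s)"
          using n_props(1)[OF n] by (simp add: powr_divide powr_minus_divide[symmetric])
        finally have "\<bar>F k x\<bar> \<le> C k * real n powr (real k - s) * (2 * ln (real n)) ^ \<mu>" .
        moreover have "\<bar>?Q x\<bar> \<le> Q * r n"
          using xz n_props(3)[OF n] by (intro Q(2) k) auto
        ultimately have "\<bar>F k x * ?Q x\<bar> \<le> C k * real n powr (real k - s) * (2 * ln (real n)) ^ \<mu> * (Q * r n)"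
          unfolding abs_mult using C n_props(2)[OF n] by (intro mult_mono) auto
        also have "\<dots> = A * Y"
          by (simp add: A_def Y_def power_mult_distrib)
        finally show ?thesis .
      qed
      have parts: "2 * real (n - k) * integral {c..d} (\<lambda>x. F k x * ?q x)
        = integral {c..d} (\<lambda>x. F (Suc k) x * ?Q x) - (F k d * ?Q d - F k c * ?Q c)"
      proof (rule jacobi_raised_by_parts[OF ab k(2)])
        fix x assume x: "x \<in> {c<..<d}"
        then have "1 / real n \<le> \<bar>x - z\<bar>" using adm by (auto simp: adm_def)
        then have "x \<noteq> z" using n_props(1)[OF n] by auto
        then have "(F k has_real_derivative F (Suc k) x) (at x within {-1..1})"
          using adm x by (intro deriv) (auto simp: adm_def)
        moreover have "at x within {-1..1} = at x"
          using adm x by (intro at_within_interior) (auto simp: adm_def)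
        ultimately show "(F k has_real_derivative F (Suc k) x) (at x)" by simp
      qed (use adm cont[OF n adm] in \<open>auto simp: adm_def\<close>)
      have "real n * \<bar>integral {c..d} (\<lambda>x. F k x * ?q x)\<bar>
          \<le> 2 * real (n - k) * \<bar>integral {c..d} (\<lambda>x. F k x * ?q x)\<bar>"
        using k by (intro mult_right_mono) auto
      also have "\<dots> = \<bar>2 * real (n - k) * integral {c..d} (\<lambda>x. F k x * ?q x)\<bar>"
        by (simp add: abs_mult)
      also have "\<dots> \<le> B * Y + A * Y + A * Y"
      proof -
        have "\<bar>F k c * ?Q c\<bar> \<le> A * Y" "\<bar>F k d * ?Q d\<bar> \<le> A * Y"
          using adm by (auto simp: adm_def intro!: boundary)
        moreover have "\<bar>integral {c..d} (\<lambda>x. F (Suc k) x * ?Q x)\<bar> \<le> B * Y"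
          using B(2)[OF n adm] by (simp add: Y_def)
        ultimately show ?thesis unfolding parts by linarith
      qed
      also have "\<dots> = real n * ((B + 2 * A) * (ln (real n) ^ \<mu> * real n powr (real k - s - 1) * r n))"
      proof -
        have "Y = real n * (ln (real n) ^ \<mu> * real n powr (real k - s - 1) * r n)"
          using n_props(1)[OF n] by (simp add: Y_def powr_diff)
        then show ?thesis by (simp add: algebra_simps)
      qed
      finally show "\<bar>integral {c..d} (\<lambda>x. F k x * ?q x)\<bar>
          \<le> (B + 2 * A) * (ln (real n) ^ \<mu> * real n powr (real k - s - 1) * r n)"
        using n_props(1)[OF n] by (simp only: mult_le_cancel_left_pos)
    qed
  qed
  then show ?thesis unfolding adm_def r_def .
qed

text \<open>The interval is cut at \<open>z \<plusminus> 1 / n\<close>. The two outer pieces are the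
  case \<open>k = 0\<close> of \<open>outer_integral_bound\<close>; the middle piece is bounded by
  its length times the suprema of the singular function and of the weighted polynomial.\<close>

lemma jacobi_integral_bound:
  fixes \<alpha> \<beta> z s :: real and \<mu> :: nat and f g :: "real \<Rightarrow> real"
  assumes ab: "\<alpha> > -1" "\<beta> > -1" and z: "z \<in> {-1<..<1}" and s: "s > 0"
    and g: "smooth_on_Icc (-1) 1 g"
    and f: "\<And>x. x \<in> {-1..1} \<Longrightarrow> f x = \<bar>x - z\<bar> powr s * ln \<bar>x - z\<bar> ^ \<mu> * g x"
  obtains B N where "\<And>n. n \<ge> N \<Longrightarrow>
    \<bar>integral {-1..1} (\<lambda>x. jacobi_weight \<alpha> \<beta> x * f x * jacobi_P \<alpha> \<beta> n x)\<bar>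
      \<le> B * (ln (real n) ^ \<mu> * real n powr (- s - 1) * sqrt (jacobi_sigma \<alpha> \<beta> n))"
proof -
  have z': "z \<in> {-1..1}" using z by auto
  obtain F C where F0: "\<And>x. x \<in> {-1..1} \<Longrightarrow> F 0 x = \<bar>x - z\<bar> powr s * ln \<bar>x - z\<bar> ^ \<mu> * g x"
    and deriv: "\<And>k x. x \<in> {-1..1} \<Longrightarrow> x \<noteq> z \<Longrightarrow>
       (F k has_real_derivative F (Suc k) x) (at x within {-1..1})"
    and C: "\<And>k. C k \<ge> 0"
    and F: "\<And>k x. x \<in> {-1..1} \<Longrightarrow> x \<noteq> z \<Longrightarrow>
       \<bar>F k x\<bar> \<le> C k * \<bar>x - z\<bar> powr (s - real k) * (1 + \<bar>ln \<bar>x - z\<bar>\<bar>) ^ \<mu>"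
    using log_singular_derivatives[OF g z', where s = s and \<mu> = \<mu>] by blast
  \<comment> \<open>Half the distance from \<open>z\<close> to the nearer endpoint.\<close>
  define \<delta> where "\<delta> = (1 - \<bar>z\<bar>) / 2"
  have \<delta>: "-1 < z - \<delta>" "z + \<delta> < 1" "\<delta> > 0"
    using z by (auto simp: \<delta>_def abs_if field_simps)
  obtain K :: nat where "s + 1 < real K" using reals_Archimedean2 by blast
  then have K: "K > 0" "s + 1 < real K" using s by (auto intro: Nat.gr0I)
  obtain N1 :: nat where N1: "1 / \<delta> \<le> real N1" using real_arch_simple by blast
  define N where "N = max (max 3 (2 * K + 2)) N1"
  have N: "3 \<le> N" "2 * K + 2 \<le> N" "1 / \<delta> \<le> real N" using N1 by (auto simp: N_def)
  define X where "X n = ln (real n) ^ \<mu> * real n powr (- s - 1) * sqrt (jacobi_sigma \<alpha> \<beta> n)" for n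
  obtain B where B: "B \<ge> 0" "\<And>n c d. n \<ge> N \<Longrightarrow> -1 \<le> c \<Longrightarrow> c \<le> d \<Longrightarrow> d \<le> 1 \<Longrightarrow>
      c = -1 \<or> c = z + 1 / real n \<Longrightarrow> d = 1 \<or> d = z - 1 / real n \<Longrightarrow>
      (\<And>x. x \<in> {c..d} \<Longrightarrow> 1 / real n \<le> \<bar>x - z\<bar>) \<Longrightarrow>
      \<bar>integral {c..d} (\<lambda>x. F 0 x * jacobi_raised \<alpha> \<beta> 0 n x)\<bar> \<le> B * X n"
    using outer_integral_bound[OF ab \<delta> deriv C F K N, of 0] unfolding X_def by auto
  obtain Q where Q: "Q \<ge> 0" "\<And>n x. 0 < n \<Longrightarrow> x \<in> {z - \<delta>..z + \<delta>} \<Longrightarrow>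
      \<bar>jacobi_raised \<alpha> \<beta> 0 n x\<bar> \<le> Q * sqrt (jacobi_sigma \<alpha> \<beta> n)"
    using jacobi_raised_interior_bound[OF ab, of "z - \<delta>" "z + \<delta>" 0] \<delta> by auto
  obtain D where D: "\<forall>x\<in>{-1..1}. D 0 x = g x"
    "\<forall>k. \<forall>x\<in>{-1..1}. (D k has_real_derivative D (Suc k) x) (at x within {-1..1})"
    using g unfolding smooth_on_Icc_def by blast
  have "continuous_on {-1..1} (D 0)" by (rule DERIV_continuous_on) (use D(2) in blast)
  then have "continuous_on {-1..1} g" by (rule continuous_on_eq) (use D(1) in blast)
  then have "bounded (g ` {-1..1})" by (intro compact_imp_bounded compact_continuous_image) auto
  then obtain G where G: "\<forall>x\<in>{-1..1}. \<bar>g x\<bar> \<le> G" by (auto simp: bounded_iff)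
  have G0: "G \<ge> 0" using G z' by (meson abs_ge_zero order.trans)
  define M where "M = max 1 (real \<mu> / s) ^ \<mu> * G"
  have M: "M \<ge> 0" using G0 by (simp add: M_def)
  show thesis
  proof (rule that[of N "B + 2 * M * Q + B", folded X_def])
    fix n assume n: "n \<ge> N"
    let ?h = "\<lambda>x. jacobi_weight \<alpha> \<beta> x * f x * jacobi_P \<alpha> \<beta> n x"
    define e where "e = 1 / real n"
    have n_pos: "real n > 0" "n > 0" using n N by auto
    have e: "e > 0" "e \<le> \<delta>"
    proof -
      have "1 / \<delta> \<le> real n" using n N by linarith
      then show "e \<le> \<delta>" using n_pos \<delta> by (simp add: e_def field_simps)
    qed (use n_pos in \<open>simp add: e_def\<close>)
    have "3 \<le> real n" using n N by simp
    then have exp_le_n: "exp 1 \<le> real n" using exp_le by linarith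
    then have ln_n: "ln (real n) \<ge> 1" using n_pos by (simp add: ln_ge_iff)
    have X: "X n \<ge> 0" unfolding X_def using ln_n jacobi_sigma_nonneg by simp
    show "\<bar>integral {-1..1} ?h\<bar> \<le> (B + 2 * M * Q + B) * X n"
    proof (cases "?h integrable_on {-1..1}")
      case False
      \<comment> \<open>This case does not occur; \<open>integral\<close> would be \<open>0\<close>, so integrability need not be proved.\<close>
      then show ?thesis using B(1) M Q(1) X by (simp add: not_integrable_integral)
    next
      case True
      have h_eq: "?h x = F 0 x * jacobi_raised \<alpha> \<beta> 0 n x" if "x \<in> {-1..1}" for x
        using that by (simp add: f F0 jacobi_raised_def mult_ac)
      have "\<bar>integral {-1..z - e} ?h\<bar> = \<bar>integral {-1..z - e} (\<lambda>x. F 0 x * jacobi_raised \<alpha> \<beta> 0 n x)\<bar>"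
        using e \<delta> by (intro arg_cong[where f = abs] integral_cong h_eq) auto
      also have "\<dots> \<le> B * X n" using e \<delta> n by (intro B(2)) (auto simp: e_def[symmetric])
      finally have left: "\<bar>integral {-1..z - e} ?h\<bar> \<le> B * X n" .
      have "\<bar>integral {z + e..1} ?h\<bar> = \<bar>integral {z + e..1} (\<lambda>x. F 0 x * jacobi_raised \<alpha> \<beta> 0 n x)\<bar>"
        using e \<delta> by (intro arg_cong[where f = abs] integral_cong h_eq) auto
      also have "\<dots> \<le> B * X n" using e \<delta> n by (intro B(2)) (auto simp: e_def[symmetric])
      finally have right: "\<bar>integral {z + e..1} ?h\<bar> \<le> B * X n" .
      define R where "R = M * (real n powr (- s) * ln (real n) ^ \<mu>) * (Q * sqrt (jacobi_sigma \<alpha> \<beta> n))"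
      have R: "R \<ge> 0" unfolding R_def using M Q(1) ln_n jacobi_sigma_nonneg by simp
      have h_le: "\<bar>?h x\<bar> \<le> R" if x: "x \<in> {z - e..z + e}" for x
      proof (cases "x = z")
        case True
        \<comment> \<open>At \<open>z\<close> the function vanishes because
          \<open>0 powr s = 0\<close>, whatever value \<open>ln 0\<close> takes.\<close>
        then show ?thesis using R z by (simp add: f)
      next
        case False
        have x': "x \<in> {-1..1}" using x e \<delta> by auto
        have "\<bar>f x\<bar> = \<bar>x - z\<bar> powr s * \<bar>ln \<bar>x - z\<bar>\<bar> ^ \<mu> * \<bar>g x\<bar>"
          using x' by (simp add: f abs_mult power_abs)
        also have "\<dots> \<le> max 1 (real \<mu> / s) ^ \<mu> * (real n powr (- s) * ln (real n) ^ \<mu>) * G"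
          using x False s exp_le_n G x' ln_n
          by (intro mult_mono powr_ln_power_le) (auto simp: e_def)
        also have "\<dots> = M * (real n powr (- s) * ln (real n) ^ \<mu>)" by (simp add: M_def mult_ac)
        finally have "\<bar>f x\<bar> \<le> M * (real n powr (- s) * ln (real n) ^ \<mu>)" .
        moreover have "\<bar>jacobi_raised \<alpha> \<beta> 0 n x\<bar> \<le> Q * sqrt (jacobi_sigma \<alpha> \<beta> n)"
          using x e by (intro Q(2) n_pos) auto
        ultimately have "\<bar>f x\<bar> * \<bar>jacobi_raised \<alpha> \<beta> 0 n x\<bar> \<le> R"
          unfolding R_def using M ln_n by (intro mult_mono) auto
        then show ?thesis by (simp add: jacobi_raised_def abs_mult mult_ac)
      qed
      have "?h integrable_on {z - e..z + e}"
        using True e \<delta> by (intro integrable_on_subinterval[OF True]) auto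
      then have "norm (integral {z - e..z + e} ?h) \<le> R * measure lborel {z - e..z + e}"
        using R h_le by (intro has_integral_bound_real[of R "{}"]) (auto intro: integrable_integral)
      \<comment> \<open>The length \<open>2 / n\<close> turns the \<open>n powr (- s)\<close> in
        \<open>R\<close> into the \<open>n powr (- s - 1)\<close> of \<open>X n\<close>.\<close>
      also have "\<dots> = 2 * M * Q * X n"
        using e n_pos by (simp add: R_def X_def e_def powr_diff)
      finally have middle: "\<bar>integral {z - e..z + e} ?h\<bar> \<le> 2 * M * Q * X n" by simp
      have "integral {-1..1} ?h = integral {-1..z - e} ?h + integral {z - e..1} ?h"
        using e \<delta> True by (intro Henstock_Kurzweil_Integration.integral_combine[symmetric]) auto
      also have "integral {z - e..1} ?h = integral {z - e..z + e} ?h + integral {z + e..1} ?h"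
        using e \<delta> integrable_on_subinterval[OF True, of "z - e" 1]
        by (intro Henstock_Kurzweil_Integration.integral_combine[symmetric]) auto
      finally show ?thesis using left middle right by (simp add: distrib_right)
    qed
  qed
qed

section \<open>From the weighted integral to the Jacobi coefficients\<close>

theorem theorem3:
  fixes \<alpha> \<beta> z\<^sub>0 s :: real and \<mu> :: nat and f g :: "real \<Rightarrow> real"
  assumes "\<alpha> > -1" and "\<beta> > -1"
    and "z\<^sub>0 \<in> {-1<..<1}"
    and "s > 0"
    and "\<mu> \<ge> 1"
    and "smooth_on_Icc (-1) 1 g"
    and "\<And>x. x \<in> {-1..1} \<Longrightarrow> f x = \<bar>x - z\<^sub>0\<bar> powr s * ln \<bar>x - z\<^sub>0\<bar> ^ \<mu> * g x"
  shows "(\<lambda>n. \<bar>jacobi_coeff \<alpha> \<beta> f n\<bar>) \<in> O(\<lambda>n. ln (real n) ^ \<mu> * real n powr (- s - 1 / 2))"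
proof -
  note ab = assms(1,2)
  obtain B N where B: "\<And>n. n \<ge> N \<Longrightarrow>
    \<bar>integral {-1..1} (\<lambda>x. jacobi_weight \<alpha> \<beta> x * f x * jacobi_P \<alpha> \<beta> n x)\<bar>
      \<le> B * (ln (real n) ^ \<mu> * real n powr (- s - 1) * sqrt (jacobi_sigma \<alpha> \<beta> n))"
    using jacobi_integral_bound[OF assms(1-4,6,7)] by blast
  \<comment> \<open>Half the limit of \<open>n * jacobi_sigma \<alpha> \<beta> n\<close>, hence
    eventually a strict lower bound for that sequence.\<close>
  define c where "c = 2 powr (\<alpha> + \<beta>) / 2"
  have c: "c > 0" "c < 2 powr (\<alpha> + \<beta>)" by (simp_all add: c_def)
  have "\<forall>\<^sub>F n in sequentially. norm \<bar>jacobi_coeff \<alpha> \<beta> f n\<bar>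
      \<le> (\<bar>B\<bar> / sqrt c) * norm (ln (real n) ^ \<mu> * real n powr (- s - 1 / 2))"
    using eventually_ge_at_top[of N] eventually_gt_at_top[of 0]
      order_tendstoD(1)[OF tendsto_jacobi_sigma[OF ab] c(2)]
  proof eventually_elim
    case (elim n)
    define r where "r = sqrt (jacobi_sigma \<alpha> \<beta> n)"
    define l where "l = ln (real n) ^ \<mu>"
    have l: "l \<ge> 0" using elim(2) by (simp add: l_def)
    have r: "r > 0" "r\<^sup>2 = jacobi_sigma \<alpha> \<beta> n"
      using jacobi_sigma_pos[OF ab elim(2)] by (auto simp: r_def)
    have "sqrt c \<le> sqrt (real n) * r"
      using elim(3) unfolding r_def real_sqrt_mult[symmetric] by (intro real_sqrt_le_mono) simp
    then have r_inv: "1 / r \<le> sqrt (real n) / sqrt c"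
      using r(1) c(1) by (simp add: field_simps)
    have "\<bar>jacobi_coeff \<alpha> \<beta> f n\<bar> = 1 / r\<^sup>2
        * \<bar>integral {-1..1} (\<lambda>x. jacobi_weight \<alpha> \<beta> x * f x * jacobi_P \<alpha> \<beta> n x)\<bar>"
      unfolding jacobi_coeff_def r(2)[symmetric] abs_mult by simp
    also have "\<dots> \<le> 1 / r\<^sup>2 * (B * (l * real n powr (- s - 1) * r))"
      using B[OF elim(1)] by (intro mult_left_mono) (auto simp: l_def r_def)
    also have "\<dots> = B * (l * real n powr (- s - 1)) * (1 / r)"
      using r(1) by (simp add: power2_eq_square)
    \<comment> \<open>The sign of \<open>B\<close> is unknown, so its absolute value is taken before
      \<open>1 / r\<close> is enlarged; the resulting \<open>sqrt n\<close> accounts for the half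
      power in the claim.\<close>
    also have "\<dots> \<le> \<bar>B\<bar> * (l * real n powr (- s - 1)) * (sqrt (real n) / sqrt c)"
      using r_inv l r(1) by (intro mult_mono) auto
    also have "\<dots> = \<bar>B\<bar> / sqrt c * (l * real n powr (- s - 1 / 2))"
    proof -
      have "real n powr (- s - 1 / 2) = real n powr (- s - 1) * real n powr (1 / 2)"
        by (simp add: algebra_simps flip: powr_add)
      then show ?thesis by (simp add: powr_half_sqrt)
    qed
    finally show ?case using l by (simp add: l_def)
  qed
  then show ?thesis by (rule bigoI)
qed

end
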